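(* Let $\alpha\in(0,2]$, and let $X$ be an $H$-self-similar process with stationary increments that is symmetric $\alpha$-stable. Let $\beta,\beta_1,\beta_2\in\mathbb{R}$ with $-\frac12<\beta<0$ and $-\frac12<\beta_1<\beta_2<0$. Assume there is a sequence $\{b_n\}_{n\in\mathbb{N}}$ of positive numbers with $\lim_{n\to+\infty}b_n=0$ and $b_{n/2}=O(b_n)$ such that for each $\gamma\in\{\beta,\beta_1,\beta_2\}$ there is a constant $C$ with $$\limsup_{n\to+\infty}\frac{1}{n b_n^2}\sum_{k\in\mathbb{Z},|k|\le n}\left|\mathrm{cov}\left(|\triangle_{k,1}X|^{\gamma},|\triangle_{0,1}X|^{\gamma}\right)\right|\le C^2 .$$ Let $\widehat H_n$ (built from $\beta$) and $\hat\alpha_n$ (built from $\beta_1,\beta_2$) be the estimators defined in the context. Then, as $n\to+\infty$, $$\widehat H_n\xrightarrow{\mathbb{P}}H,\qquad \hat\alpha_n\xrightarrow{\mathbb{P}}\alpha,$$ and moreover $$\widehat H_n-H=O_{\mathbb{P}}(b_n),\qquad \hat\alpha_n-\alpha=O_{\mathbb{P}}(b_n).$$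
   Context: A real process $X$ is $H$-self-similar if for all $a>0$, $\{X(at)\}_t\stackrel{(d)}{=}a^H\{X(t)\}_t$, and has stationary increments if for all $s$, $\{X(t+s)-X(s)\}_t\stackrel{(d)}{=}\{X(t)-X(0)\}_t$ (equality of finite-dimensional distributions). "$H$-sssi" means both. A random variable $Y$ is symmetric $\alpha$-stable ($S\alpha S$), $\alpha\in(0,2]$, if $\mathbb{E}e^{i\theta Y}=\exp(-\sigma^\alpha|\theta|^\alpha)$ for some $\sigma>0$. A process is $S\alpha S$ if its finite linear combinations are $S\alpha S$ (possibly degenerate); it is understood that $\triangle_{0,1}X$ below is non-degenerate ($\sigma>0$). Increments: fix integers $L\ge1,K\ge1$ and reals $a_0,\dots,a_K$ with $\sum_{k=0}^K k^q a_k=0$ for all $q\in\{0,\dots,L\}$ and $\sum_{k=0}^K k^{L+1}a_k\ne0$ (convention $0^0=1$). Set $\triangle_{p,n}X=\sum_{k=0}^K a_k X\left(\frac{k+p}{n}\right)$. For $\gamma\in(-\frac12,0)$: $V_n(\gamma)=\frac{1}{n-K+1}\sum_{p=0}^{n-K}|\triangle_{p,n}X|^{\gamma}$ and $W_n(\gamma)=n^{\gamma H}V_n(\gamma)$. When $n/2$ appears, $n$ is even (and large enough). Estimator of $H$: $\widehat H_n=\frac1\beta\log_2\frac{V_{n/2}(\beta)}{V_n(\beta)}$. Estimator of $\alpha$: for $u>v>0$ let $\psi_{u,v}:\mathbb{R}^+\times\mathbb{R}^+\to\mathbb{R}$, $\psi_{u,v}(x,y)=-v\ln x+u\ln y+C(u,v)$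 with $C(u,v)=\frac{u-v}{2}\ln\pi+u\ln\Gamma(1+\frac v2)+v\ln\Gamma(\frac{1-u}{2})-v\ln\Gamma(1+\frac u2)-u\ln\Gamma(\frac{1-v}{2})$; $h_{u,v}:(0,+\infty)\to(-\infty,0)$, $h_{u,v}(x)=u\ln\Gamma(1+\frac vx)-v\ln\Gamma(1+\frac ux)$, which is a bijection; $\varphi_{u,v}:\mathbb{R}\to[0,+\infty)$, $\varphi_{u,v}(x)=0$ if $x\ge0$ and $\varphi_{u,v}(x)=h_{u,v}^{-1}(x)$ if $x<0$. Then $\hat\alpha_n=\varphi_{-\beta_1,-\beta_2}\left(\psi_{-\beta_1,-\beta_2}(W_n(\beta_1),W_n(\beta_2))\right)$. $X_n=O_{\mathbb{P}}(1)$ means: for all $\epsilon>0$ there is $M>0$ with $\sup_n\mathbb{P}(|X_n|>M)<\epsilon$. $Y_n=O_{\mathbb{P}}(a_n)$ means $Y_n=a_nX_n$ with $X_n=O_{\mathbb{P}}(1)$. *)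

theory Defs
  imports "HOL-Probability.Probability"
begin

section \<open>Self-similar stable processes with stationary increments\<close>

text \<open>A real process on a probability space \<open>M\<close> is a map \<open>X :: real \<Rightarrow> 'a \<Rightarrow> real\<close> whose values
  \<open>X t\<close> are random variables; the time set is the whole real line.\<close>

definition real_process :: "'a measure \<Rightarrow> (real \<Rightarrow> 'a \<Rightarrow> real) \<Rightarrow> bool" where
  "real_process M X \<longleftrightarrow> (\<forall>t. X t \<in> borel_measurable M)"

definition fdd_eq :: "'a measure \<Rightarrow> (real \<Rightarrow> 'a \<Rightarrow> real) \<Rightarrow> (real \<Rightarrow> 'a \<Rightarrow> real) \<Rightarrow> bool" where
  "fdd_eq M X Y \<longleftrightarrow>
     (\<forall>T. finite T \<longrightarrow>
        distr M (\<Pi>\<^sub>M t\<in>T. borel) (\<lambda>\<omega>. \<lambda>t\<in>T. X t \<omega>) =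
        distr M (\<Pi>\<^sub>M t\<in>T. borel) (\<lambda>\<omega>. \<lambda>t\<in>T. Y t \<omega>))"

definition self_similar :: "'a measure \<Rightarrow> real \<Rightarrow> (real \<Rightarrow> 'a \<Rightarrow> real) \<Rightarrow> bool" where
  "self_similar M H X \<longleftrightarrow>
     (\<forall>c>0. fdd_eq M (\<lambda>t. X (c * t)) (\<lambda>t \<omega>. c powr H * X t \<omega>))"

definition stationary_increments :: "'a measure \<Rightarrow> (real \<Rightarrow> 'a \<Rightarrow> real) \<Rightarrow> bool" where
  "stationary_increments M X \<longleftrightarrow>
     (\<forall>s. fdd_eq M (\<lambda>t \<omega>. X (t + s) \<omega> - X s \<omega>) (\<lambda>t \<omega>. X t \<omega> - X 0 \<omega>))"

text \<open>\<open>SaS_scale M \<alpha> \<sigma> Y\<close>: \<open>Y\<close> has characteristic function \<open>exp (- \<sigma>\<^sup>\<alpha> \<bar>\<theta>\<bar>\<^sup>\<alpha>)\<close>. The value \<open>\<sigma> = 0\<close>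
  is the degenerate case \<open>Y = 0\<close> almost surely.\<close>

definition SaS_scale :: "'a measure \<Rightarrow> real \<Rightarrow> real \<Rightarrow> ('a \<Rightarrow> real) \<Rightarrow> bool" where
  "SaS_scale M \<alpha> \<sigma> Y \<longleftrightarrow>
     Y \<in> borel_measurable M \<and>
     (\<forall>\<theta>. char (distr M borel Y) \<theta> = of_real (exp (- (\<sigma> powr \<alpha> * \<bar>\<theta>\<bar> powr \<alpha>))))"

definition SaS_variable :: "'a measure \<Rightarrow> real \<Rightarrow> ('a \<Rightarrow> real) \<Rightarrow> bool" where
  "SaS_variable M \<alpha> Y \<longleftrightarrow> (\<exists>\<sigma>>0. SaS_scale M \<alpha> \<sigma> Y)"

definition SaS_process :: "'a measure \<Rightarrow> real \<Rightarrow> (real \<Rightarrow> 'a \<Rightarrow> real) \<Rightarrow> bool" where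
  "SaS_process M \<alpha> X \<longleftrightarrow>
     (\<forall>T c. finite T \<longrightarrow> (\<exists>\<sigma>\<ge>0. SaS_scale M \<alpha> \<sigma> (\<lambda>\<omega>. \<Sum>t\<in>T. c t * X t \<omega>)))"

section \<open>Increments and negative power variations\<close>

text \<open>The coefficient sequence is \<open>a 0, \<dots>, a K\<close>; values of \<open>a\<close> beyond \<open>K\<close> are never used.
  The library's \<open>0 ^ 0 = 1\<close> is the intended convention.\<close>

definition increment_coeffs :: "nat \<Rightarrow> nat \<Rightarrow> (nat \<Rightarrow> real) \<Rightarrow> bool" where
  "increment_coeffs L K a \<longleftrightarrow>
     (\<forall>q\<le>L. (\<Sum>k\<le>K. real k ^ q * a k) = 0) \<and> (\<Sum>k\<le>K. real k ^ (L + 1) * a k) \<noteq> 0"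

definition incr ::
  "nat \<Rightarrow> (nat \<Rightarrow> real) \<Rightarrow> (real \<Rightarrow> 'a \<Rightarrow> real) \<Rightarrow> int \<Rightarrow> nat \<Rightarrow> 'a \<Rightarrow> real" where
  "incr K a X p n \<omega> = (\<Sum>k\<le>K. a k * X (real_of_int (int k + p) / real n) \<omega>)"

text \<open>\<open>V\<close> is meaningful for \<open>n \<ge> K\<close>. Since \<open>0 powr \<gamma> = 0\<close> in the library, negative powers are total;
  this convention only matters where some increment vanishes.\<close>

definition V ::
  "nat \<Rightarrow> (nat \<Rightarrow> real) \<Rightarrow> (real \<Rightarrow> 'a \<Rightarrow> real) \<Rightarrow> real \<Rightarrow> nat \<Rightarrow> 'a \<Rightarrow> real" where
  "V K a X \<gamma> n \<omega> =
     1 / (real n - real K + 1) * (\<Sum>p = 0..int n - int K. \<bar>incr K a X p n \<omega>\<bar> powr \<gamma>)"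

definition W ::
  "nat \<Rightarrow> (nat \<Rightarrow> real) \<Rightarrow> (real \<Rightarrow> 'a \<Rightarrow> real) \<Rightarrow> real \<Rightarrow> real \<Rightarrow> nat \<Rightarrow> 'a \<Rightarrow> real" where
  "W K a X H \<gamma> n \<omega> = real n powr (\<gamma> * H) * V K a X \<gamma> n \<omega>"

section \<open>The estimators\<close>

text \<open>Used for even \<open>n\<close> only, where \<open>n div 2\<close> is the exact half of \<open>n\<close>.\<close>

definition H_hat ::
  "nat \<Rightarrow> (nat \<Rightarrow> real) \<Rightarrow> (real \<Rightarrow> 'a \<Rightarrow> real) \<Rightarrow> real \<Rightarrow> nat \<Rightarrow> 'a \<Rightarrow> real" where
  "H_hat K a X \<beta> n \<omega> = 1 / \<beta> * log 2 (V K a X \<beta> (n div 2) \<omega> / V K a X \<beta> n \<omega>)"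

definition C_const :: "real \<Rightarrow> real \<Rightarrow> real" where
  "C_const u v =
     (u - v) / 2 * ln pi + u * ln (Gamma (1 + v / 2)) + v * ln (Gamma ((1 - u) / 2))
       - v * ln (Gamma (1 + u / 2)) - u * ln (Gamma ((1 - v) / 2))"

definition psi :: "real \<Rightarrow> real \<Rightarrow> real \<Rightarrow> real \<Rightarrow> real" where
  "psi u v x y = - v * ln x + u * ln y + C_const u v"

definition h_fun :: "real \<Rightarrow> real \<Rightarrow> real \<Rightarrow> real" where
  "h_fun u v x = u * ln (Gamma (1 + v / x)) - v * ln (Gamma (1 + u / x))"

text \<open>For \<open>u > v > 0\<close> the function \<open>h_fun u v\<close> is a bijection from the positive onto the negative
  reals, and \<open>inv_into {0<..}\<close> is its inverse on the negative reals.\<close>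

definition phi :: "real \<Rightarrow> real \<Rightarrow> real \<Rightarrow> real" where
  "phi u v x = (if x \<ge> 0 then 0 else inv_into {0<..} (h_fun u v) x)"

definition alpha_hat ::
  "nat \<Rightarrow> (nat \<Rightarrow> real) \<Rightarrow> (real \<Rightarrow> 'a \<Rightarrow> real) \<Rightarrow> real \<Rightarrow> real \<Rightarrow> real \<Rightarrow> nat \<Rightarrow> 'a \<Rightarrow> real" where
  "alpha_hat K a X H \<beta>1 \<beta>2 n \<omega> =
     phi (- \<beta>1) (- \<beta>2) (psi (- \<beta>1) (- \<beta>2) (W K a X H \<beta>1 n \<omega>) (W K a X H \<beta>2 n \<omega>))"

section \<open>Covariance and stochastic asymptotics\<close>

definition covariance :: "'a measure \<Rightarrow> ('a \<Rightarrow> real) \<Rightarrow> ('a \<Rightarrow> real) \<Rightarrow> real" where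
  "covariance M Y Z =
     (\<integral>\<omega>. (Y \<omega> - (\<integral>\<omega>'. Y \<omega>' \<partial>M)) * (Z \<omega> - (\<integral>\<omega>'. Z \<omega>' \<partial>M)) \<partial>M)"

text \<open>The sequences of estimators are only defined for some indices (\<open>n \<ge> K\<close>, or \<open>n\<close> even and
  \<open>n \<ge> 2 K\<close>), so the stochastic limit notions take the infinite set \<open>I\<close> of admissible indices as a
  parameter; \<open>n \<rightarrow> \<infinity>\<close> is along \<open>I\<close>. Measurability is part of the notions because \<open>measure\<close> is \<open>0\<close> on
  non-measurable sets.\<close>

definition converges_in_prob ::
  "'a measure \<Rightarrow> nat set \<Rightarrow> (nat \<Rightarrow> 'a \<Rightarrow> real) \<Rightarrow> real \<Rightarrow> bool" where
  "converges_in_prob M I Y c \<longleftrightarrow>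
     (\<forall>n\<in>I. Y n \<in> borel_measurable M) \<and>
     (\<forall>\<epsilon>>0. ((\<lambda>n. measure M {\<omega> \<in> space M. \<bar>Y n \<omega> - c\<bar> > \<epsilon>}) \<longlongrightarrow> 0)
              (inf sequentially (principal I)))"

definition bounded_in_prob :: "'a measure \<Rightarrow> nat set \<Rightarrow> (nat \<Rightarrow> 'a \<Rightarrow> real) \<Rightarrow> bool" where
  "bounded_in_prob M I Z \<longleftrightarrow>
     (\<forall>n\<in>I. Z n \<in> borel_measurable M) \<and>
     (\<forall>\<epsilon>>0. \<exists>B>0. (SUP n\<in>I. measure M {\<omega> \<in> space M. \<bar>Z n \<omega>\<bar> > B}) < \<epsilon>)"

definition bigo_in_prob ::
  "'a measure \<Rightarrow> nat set \<Rightarrow> (nat \<Rightarrow> 'a \<Rightarrow> real) \<Rightarrow> (nat \<Rightarrow> real) \<Rightarrow> bool" where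
  "bigo_in_prob M I Y r \<longleftrightarrow>
     (\<exists>Z. bounded_in_prob M I Z \<and> (\<forall>n\<in>I. \<forall>\<omega>\<in>space M. Y n \<omega> = r n * Z n \<omega>))"

end

theory Submission
  imports Defs
begin

text \<open>
  By self-similarity, stationarity of the increments and the vanishing sum of the coefficients, the
  rescaled increments \<open>n powr H * incr K a X p n\<close> all have the law of the symmetric stable variable
  \<open>Y = incr K a X 0 1\<close>, and two of them have the joint law of two increments with unit time step at lag
  \<open>p - q\<close> (\<open>distr_incr_pair\<close>). Hence the statistic \<open>W\<close> is an average of identically distributed
  variables with mean \<open>E \<bar>Y\<bar> powr \<gamma>\<close>, and its mean square error is at most a constant times
  \<open>1 / n\<close> times the sum of the absolute covariances, that is, of order \<open>(b n)\<^sup>2\<close> by hypothesis. Chebyshev's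
  inequality shows that \<open>W\<close> minus its mean is of stochastic order \<open>b n\<close> (\<open>bigo_in_prob_W\<close>).

  For this the moments of negative order of a stable variable must be finite, up to order \<open>2 * \<gamma> > -1\<close>,
  and for the estimator of \<open>\<alpha>\<close> they must be known explicitly. Both come from
  \<open>nn_integral_SaS_neg_powr\<close>: a negative power is a mixture of Gaussian kernels, and the expectation of a
  Gaussian kernel is, by Parseval's relation, a normal expectation of the stable characteristic function.

  Both estimators are functions of two such statistics. The estimator of \<open>H\<close> is a logarithm of the ratio
  of the half-sample and the full-sample statistic, from which the moment cancels. The estimator of \<open>\<alpha>\<close> is
  \<open>phi\<close> applied to \<open>psi\<close> of the statistics for \<open>\<beta>1\<close> and \<open>\<beta>2\<close>; at the true moments \<open>psi\<close> takes the value
  \<open>h_fun\<close> at \<open>\<alpha>\<close> (\<open>psi_neg_moment\<close>), which \<open>phi\<close> inverts. As \<open>h_fun\<close> has positive derivative by strict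
  convexity of \<open>ln Gamma\<close>, both functions are differentiable at the true moments, and the delta method
  (\<open>bigo_in_prob_delta_method\<close>) transfers the rate \<open>b n\<close> to the estimators. Convergence in probability
  follows because \<open>b\<close> tends to zero.
\<close>

section \<open>Moments of negative order of a stable variable\<close>

text \<open>The substitution \<open>s = c * t powr r\<close> turns this Mellin transform into Euler's Gamma integral. It is
used three times: with \<open>r = 2\<close> for the weight that represents a negative power and for the moments of
the normal law, and with \<open>r = \<alpha>\<close> for the stable characteristic function.\<close>

lemma nn_integral_powr_exp_powr:
  fixes c q r :: real
  assumes c: "c > 0" and q: "q > 0" and r: "r > 0"
  shows "(\<integral>\<^sup>+t. ennreal (indicator {0<..} t * (t powr (q - 1) * exp (- (c * t powr r)))) \<partial>lborel)
       = ennreal (c powr (- q / r) * Gamma (q / r) / r)"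
proof -
  let ?g = "\<lambda>t. c * t powr r"
  let ?g' = "\<lambda>t. c * r * t powr (r - 1)"
  let ?f = "\<lambda>t. t powr (q / r - 1) / exp t"
  let ?h = "\<lambda>t. t powr (q - 1) * exp (- (c * t powr r))"
  have qr: "q / r > 0" using q r by simp
  have inj: "inj_on ?g {0<..}"
  proof (rule inj_onI)
    fix x y :: real assume xy: "x \<in> {0<..}" "y \<in> {0<..}" "?g x = ?g y"
    then have "x powr r = y powr r" using c by simp
    then have "(x powr r) powr (1 / r) = (y powr r) powr (1 / r)" by simp
    then show "x = y" using xy r by (simp add: powr_powr)
  qed
  have img: "?g ` {0<..} = {0<..}"
  proof (intro equalityI subsetI)
    fix y :: real assume y: "y \<in> {0<..}"
    then have "y = ?g ((y / c) powr (1 / r))" using c r by (simp add: powr_powr)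
    moreover have "(y / c) powr (1 / r) \<in> {0<..}" using y c by simp
    ultimately show "y \<in> ?g ` {0<..}" by blast
  qed (use c in auto)
  have der: "(?g has_field_derivative ?g' x) (at x within {0<..})" if "x \<in> {0<..}" for x
  proof -
    have "x > 0" using that by simp
    then have "((\<lambda>t. t powr r) has_field_derivative r * x powr (r - 1)) (at x)"
      by (rule has_real_derivative_powr)
    then have "(?g has_field_derivative c * (r * x powr (r - 1))) (at x)"
      by (rule DERIV_cmult)
    then show ?thesis
      by (simp add: has_field_derivative_at_within mult.assoc)
  qed
  have "((\<lambda>t. if t \<in> {0<..} then ?f t else 0) has_integral Gamma (q / r)) {0..}"
    by (rule has_integral_spike[OF _ _ Gamma_integral_real[OF qr], of "{0}"]) auto
  then have gi: "(?f has_integral Gamma (q / r)) {0<..}"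
    by (subst (asm) has_integral_restrict) auto
  then have "?f absolutely_integrable_on {0<..}"
    by (intro nonnegative_absolutely_integrable_1) (auto simp: has_integral_integrable)
  with gi have "?f absolutely_integrable_on (?g ` {0<..}) \<and> integral (?g ` {0<..}) ?f = Gamma (q / r)"
    unfolding img by (simp add: integral_unique)
  then have subst: "(\<lambda>x. \<bar>?g' x\<bar> * ?f (?g x)) absolutely_integrable_on {0<..} \<and>
             integral {0<..} (\<lambda>x. \<bar>?g' x\<bar> * ?f (?g x)) = Gamma (q / r)"
    by (intro has_absolute_integral_change_of_variables_1'[THEN iffD2] der inj) simp_all
  have 1: "((\<lambda>x. \<bar>?g' x\<bar> * ?f (?g x)) has_integral Gamma (q / r)) {0<..}"
    using integrable_integral[OF set_lebesgue_integral_eq_integral(1)[OF conjunct1[OF subst]]]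
    by (simp only: conjunct2[OF subst])
  have 2: "\<bar>?g' x\<bar> * ?f (?g x) = c powr (q / r) * r * ?h x" if "x \<in> {0<..}" for x
  proof -
    have x: "x > 0" using that by simp
    have "\<bar>?g' x\<bar> * ?f (?g x) = c * r * x powr (r - 1) * (c powr (q / r - 1) * x powr (q - r)) * exp (- ?g x)"
    proof -
      have "?g x powr (q / r - 1) = c powr (q / r - 1) * x powr (q - r)"
        using x c r by (simp add: powr_mult powr_powr right_diff_distrib)
      moreover have "\<bar>?g' x\<bar> = c * r * x powr (r - 1)" using x c r by simp
      ultimately show ?thesis by (simp only: exp_minus divide_inverse mult.assoc)
    qed
    also have "\<dots> = (c powr 1 * c powr (q / r - 1)) * r * (x powr (r - 1) * x powr (q - r)) * exp (- ?g x)"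
      using c by simp
    also have "\<dots> = c powr (q / r) * r * ?h x"
      unfolding powr_add[symmetric] by (simp add: mult_ac)
    finally show ?thesis .
  qed
  have "((\<lambda>x. c powr (q / r) * r * ?h x) has_integral Gamma (q / r)) {0<..}"
    using 1 2 by (rule has_integral_eq[rotated])
  then have "((\<lambda>x. inverse (c powr (q / r) * r) * (c powr (q / r) * r * ?h x))
       has_integral (inverse (c powr (q / r) * r) * Gamma (q / r))) {0<..}"
    by (rule has_integral_mult_right)
  moreover have "inverse D * (D * y) = y" if "D \<noteq> 0" for D y :: real
    using that by simp
  then have "inverse (c powr (q / r) * r) * (c powr (q / r) * r * ?h x) = ?h x" for x
    using c r by (metis mult_eq_0_iff powr_eq_0_iff less_irrefl)
  moreover have "inverse (c powr (q / r) * r) * Gamma (q / r) = c powr (- q / r) * Gamma (q / r) / r"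
    using c r by (simp add: powr_minus field_simps)
  ultimately have "(?h has_integral (c powr (- q / r) * Gamma (q / r) / r)) {0<..}"
    by (simp only:)
  from nn_integral_has_integral_lebesgue[OF _ this] show ?thesis by simp
qed

text \<open>Parseval's relation: both sides are the double integral of \<open>iexp (t * x * y)\<close>, whose integrand is bounded.\<close>

lemma integral_char_exchange:
  assumes "real_distribution \<mu>" "real_distribution \<nu>"
  shows "(\<integral>x. char \<mu> (t * x) \<partial>\<nu>) = (\<integral>y. char \<nu> (t * y) \<partial>\<mu>)"
proof -
  interpret \<mu>: real_distribution \<mu> by fact
  interpret \<nu>: real_distribution \<nu> by fact
  interpret P: pair_prob_space \<nu> \<mu> ..
  have "integrable (\<nu> \<Otimes>\<^sub>M \<mu>) (\<lambda>(x, y). iexp (t * x * y))"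
    by (rule P.integrable_const_bound[where B = 1]) (auto simp: split_beta)
  then have "(\<integral>x. \<integral>y. iexp (t * x * y) \<partial>\<mu> \<partial>\<nu>) = (\<integral>y. \<integral>x. iexp (t * x * y) \<partial>\<nu> \<partial>\<mu>)"
    by (rule P.Fubini_integral[symmetric])
  then show ?thesis
    unfolding char_def by (simp add: mult_ac)
qed

text \<open>The Gaussian kernel is the characteristic function of the standard normal law, so Parseval's relation
turns its integral against \<open>\<mu>\<close> into a normal expectation of the characteristic function of \<open>\<mu>\<close>.\<close>

lemma nn_integral_exp_square_conv_char:
  assumes \<mu>: "real_distribution \<mu>"
    and char: "\<And>\<theta>. char \<mu> \<theta> = of_real (f \<theta>)" and f: "\<And>\<theta>. f \<theta> \<ge> 0" "\<And>\<theta>. f \<theta> \<le> 1"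
    and [measurable]: "f \<in> borel_measurable borel"
  shows "(\<integral>\<^sup>+y. ennreal (exp (- (t\<^sup>2 * y\<^sup>2 / 2))) \<partial>\<mu>) = (\<integral>\<^sup>+x. ennreal (f (t * x)) \<partial>std_normal_distribution)"
proof -
  interpret \<mu>: real_distribution \<mu> by fact
  interpret \<nu>: real_distribution std_normal_distribution by (rule real_dist_normal_dist)
  have i1: "integrable \<mu> (\<lambda>y. exp (- (t\<^sup>2 * y\<^sup>2 / 2)))"
    by (rule \<mu>.integrable_const_bound[where B = 1]) auto
  have i2: "integrable std_normal_distribution (\<lambda>x. f (t * x))"
    by (rule \<nu>.integrable_const_bound[where B = 1]) (use f in \<open>auto simp: abs_le_iff\<close>)
  have "complex_of_real (\<integral>x. f (t * x) \<partial>std_normal_distribution)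
      = (\<integral>x. char \<mu> (t * x) \<partial>std_normal_distribution)"
    by (simp add: char)
  also have "\<dots> = (\<integral>y. char std_normal_distribution (t * y) \<partial>\<mu>)"
    by (rule integral_char_exchange[OF \<mu> real_dist_normal_dist])
  also have "\<dots> = complex_of_real (\<integral>y. exp (- (t\<^sup>2 * y\<^sup>2 / 2)) \<partial>\<mu>)"
    unfolding char_std_normal_distribution by (simp add: power_mult_distrib)
  finally have "(\<integral>x. f (t * x) \<partial>std_normal_distribution) = (\<integral>y. exp (- (t\<^sup>2 * y\<^sup>2 / 2)) \<partial>\<mu>)"
    by (simp only: of_real_eq_iff)
  then show ?thesis
    using i1 i2 f(1) by (simp add: nn_integral_eq_integral)
qed

lemma nn_integral_std_normal_powr:
  assumes "0 < p" "p < 1"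
  shows "(\<integral>\<^sup>+x. ennreal (\<bar>x\<bar> powr (- p)) \<partial>std_normal_distribution)
    = ennreal (2 powr (- p / 2) * Gamma ((1 - p) / 2) / sqrt pi)"
proof -
  let ?k = "\<lambda>x::real. std_normal_density x * \<bar>x\<bar> powr (- p)"
  let ?h = "\<lambda>x::real. indicator {0<..} x * (x powr ((1 - p) - 1) * exp (- (1/2 * x powr 2)))"
  have k: "indicator {0<..} x * ?k x = 1 / sqrt (2 * pi) * ?h x" for x
    by (cases "x > 0") (auto simp: std_normal_density_def indicator_def powr_numeral mult_ac)
  have pos: "(\<integral>\<^sup>+x. ennreal (indicator {0<..} x * ?k x) \<partial>lborel)
      = ennreal (1 / sqrt (2 * pi) * ((1/2) powr (- (1 - p) / 2) * Gamma ((1 - p) / 2) / 2))"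
  proof -
    have "(\<integral>\<^sup>+x. ennreal (indicator {0<..} x * ?k x) \<partial>lborel)
       = (\<integral>\<^sup>+x. ennreal (1 / sqrt (2 * pi)) * ennreal (?h x) \<partial>lborel)"
      unfolding k by (intro nn_integral_cong ennreal_mult) (auto simp: indicator_def)
    also have "\<dots> = ennreal (1 / sqrt (2 * pi)) * (\<integral>\<^sup>+x. ennreal (?h x) \<partial>lborel)"
      by (rule nn_integral_cmult) auto
    also have "(\<integral>\<^sup>+x. ennreal (?h x) \<partial>lborel) = ennreal ((1/2) powr (- (1 - p) / 2) * Gamma ((1 - p) / 2) / 2)"
      using assms by (intro nn_integral_powr_exp_powr) auto
    also have "ennreal (1 / sqrt (2 * pi)) * \<dots>
        = ennreal (1 / sqrt (2 * pi) * ((1/2) powr (- (1 - p) / 2) * Gamma ((1 - p) / 2) / 2))"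
      using assms by (intro ennreal_mult[symmetric]) auto
    finally show ?thesis .
  qed
  \<comment> \<open>The density is even, so both half-lines contribute equally.\<close>
  have neg: "(\<integral>\<^sup>+x. ennreal (indicator {..<0} x * ?k x) \<partial>lborel)
      = (\<integral>\<^sup>+x. ennreal (indicator {0<..} x * ?k x) \<partial>lborel)"
  proof -
    have "(\<integral>\<^sup>+x. ennreal (indicator {..<0} x * ?k x) \<partial>lborel)
      = ennreal \<bar>- 1\<bar> * (\<integral>\<^sup>+x. ennreal (indicator {..<0} (0 + (-1) * x) * ?k (0 + (-1) * x)) \<partial>lborel)"
      by (rule nn_integral_real_affine) auto
    also have "(\<lambda>x. indicator {..<0::real} (0 + (-1) * x) * ?k (0 + (-1) * x)) = (\<lambda>x. indicator {0<..} x * ?k x)"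
      by (auto simp: fun_eq_iff indicator_def std_normal_density_def)
    finally show ?thesis by simp
  qed
  have "(\<integral>\<^sup>+x. ennreal (\<bar>x\<bar> powr (- p)) \<partial>std_normal_distribution) = (\<integral>\<^sup>+x. ennreal (?k x) \<partial>lborel)"
    by (subst nn_integral_density) (auto simp: ennreal_mult)
  also have "\<dots> = (\<integral>\<^sup>+x. ennreal (indicator {0<..} x * ?k x) + ennreal (indicator {..<0} x * ?k x) \<partial>lborel)"
    by (intro nn_integral_cong) (auto simp: indicator_def)
  also have "\<dots> = (\<integral>\<^sup>+x. ennreal (indicator {0<..} x * ?k x) \<partial>lborel)
      + (\<integral>\<^sup>+x. ennreal (indicator {..<0} x * ?k x) \<partial>lborel)"
    by (rule nn_integral_add) auto
  also have "\<dots> = ennreal (2 * (1 / sqrt (2 * pi) * ((1/2) powr (- (1 - p) / 2) * Gamma ((1 - p) / 2) / 2)))"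
    unfolding neg pos using assms by (subst ennreal_plus[symmetric]) auto
  also have "2 * (1 / sqrt (2 * pi) * ((1/2) powr (- (1 - p) / 2) * Gamma ((1 - p) / 2) / 2))
     = 2 powr (- p / 2) * Gamma ((1 - p) / 2) / sqrt pi"
  proof -
    have "(1/2::real) powr (- (1 - p) / 2) = (2 powr (-1)) powr (- (1 - p) / 2)"
      by (simp add: powr_minus_divide)
    also have "\<dots> = 2 powr ((1 - p) / 2)"
      by (simp only: powr_powr) simp
    also have "\<dots> = 2 powr (1/2) * 2 powr (- p / 2)"
      by (simp add: powr_add[symmetric] field_simps)
    finally show ?thesis by (simp add: powr_half_sqrt real_sqrt_mult field_simps)
  qed
  finally show ?thesis .
qed

text \<open>The value of \<open>E \<bar>Y\<bar> powr (- p)\<close> for a symmetric \<open>\<alpha>\<close>-stable variable \<open>Y\<close> of scale \<open>\<sigma>\<close>.\<close>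

definition neg_moment :: "real \<Rightarrow> real \<Rightarrow> real \<Rightarrow> real" where
  "neg_moment \<alpha> \<sigma> p = \<sigma> powr (- p) * 2 powr (- p) * Gamma ((1 - p) / 2) * Gamma (1 + p / \<alpha>)
      / (sqrt pi * Gamma (1 + p / 2))"

text \<open>Integrating \<open>t powr (p - 1) * exp (- t\<^sup>2 * y\<^sup>2 / 2)\<close> over \<open>t > 0\<close> gives a constant multiple \<open>A\<close> of
\<open>\<bar>y\<bar> powr (- p)\<close>. Taking the expectation at \<open>y = Y\<close> and exchanging the integrals, Parseval's relation
replaces the Gaussian kernel by \<open>exp (- \<sigma> powr \<alpha> * \<bar>t * x\<bar> powr \<alpha>)\<close> with \<open>x\<close> standard normal.
The integral over \<open>t\<close> can then be done again and leaves the moment of order \<open>- p\<close> of the normal law.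
All integrands are nonnegative, so finiteness is part of the result. It also shows that \<open>Y \<noteq> 0\<close> almost
surely, since the inner integral is infinite at \<open>y = 0\<close>; this is what makes the convention
\<open>0 powr (- p) = 0\<close> harmless.\<close>

lemma nn_integral_SaS_neg_powr:
  assumes Y: "prob_space M" "SaS_scale M \<alpha> \<sigma> Y" and \<alpha>: "\<alpha> > 0" and \<sigma>: "\<sigma> > 0"
    and p: "0 < p" "p < 1"
  shows "(\<integral>\<^sup>+\<omega>. ennreal (\<bar>Y \<omega>\<bar> powr (- p)) \<partial>M) = ennreal (neg_moment \<alpha> \<sigma> p)"
proof -
  interpret prob_space M by fact
  have [measurable]: "Y \<in> borel_measurable M" using Y by (simp add: SaS_scale_def)
  define \<mu> where "\<mu> = distr M borel Y"
  have \<mu>: "real_distribution \<mu>" unfolding \<mu>_def by (rule real_distribution_distr) simp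
  interpret \<mu>: real_distribution \<mu> by fact
  interpret \<nu>: real_distribution std_normal_distribution by (rule real_dist_normal_dist)
  interpret P1: pair_sigma_finite lborel \<mu> ..
  interpret P2: pair_sigma_finite lborel std_normal_distribution ..
  define f where "f = (\<lambda>\<theta>::real. exp (- (\<sigma> powr \<alpha> * \<bar>\<theta>\<bar> powr \<alpha>)))"
  have [measurable]: "f \<in> borel_measurable borel" unfolding f_def by simp
  have char: "char \<mu> \<theta> = of_real (f \<theta>)" for \<theta>
    using Y unfolding SaS_scale_def \<mu>_def f_def by blast
  define w where "w = (\<lambda>t::real. indicator {0<..} t * t powr (p - 1))"
  have w0: "w t \<ge> 0" for t by (simp add: w_def)
  have [measurable]: "w \<in> borel_measurable borel" unfolding w_def by simp
  define A where "A = (1/2) powr (- p / 2) * Gamma (p / 2) / 2"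
  define B where "B = Gamma (p / \<alpha>) / \<alpha>"
  define G where "G = 2 powr (- p / 2) * Gamma ((1 - p) / 2) / sqrt pi"
  have A: "A > 0" and B: "B > 0" and G: "G > 0" using p \<alpha> by (auto simp: A_def B_def G_def)
  have inner\<mu>: "(\<integral>\<^sup>+t. ennreal (w t * exp (- (t\<^sup>2 * y\<^sup>2 / 2))) \<partial>lborel) = ennreal (A * \<bar>y\<bar> powr (- p))"
    if "y \<noteq> 0" for y
  proof -
    have "(\<integral>\<^sup>+t. ennreal (w t * exp (- (t\<^sup>2 * y\<^sup>2 / 2))) \<partial>lborel)
      = (\<integral>\<^sup>+t. ennreal (indicator {0<..} t * (t powr (p - 1) * exp (- (y\<^sup>2 / 2 * t powr 2)))) \<partial>lborel)"
      by (intro nn_integral_cong) (auto simp: w_def indicator_def powr_numeral mult_ac)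
    also have "\<dots> = ennreal ((y\<^sup>2 / 2) powr (- p / 2) * Gamma (p / 2) / 2)"
      using that p by (intro nn_integral_powr_exp_powr) auto
    also have "(y\<^sup>2 / 2) powr (- p / 2) = (1 / 2) powr (- p / 2) * \<bar>y\<bar> powr (- p)"
    proof -
      have "(y\<^sup>2 / 2) powr (- p / 2) = (1/2 * \<bar>y\<bar> powr 2) powr (- p / 2)"
        using that by (simp add: powr_numeral)
      also have "\<dots> = (1/2) powr (- p / 2) * (\<bar>y\<bar> powr 2) powr (- p / 2)"
        by (rule powr_mult; simp)
      also have "(\<bar>y\<bar> powr 2) powr (- p / 2) = \<bar>y\<bar> powr (- p)"
        by (subst powr_powr) simp
      finally show ?thesis .
    qed
    finally show ?thesis by (simp add: A_def mult_ac)
  qed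
  have inner0: "(\<integral>\<^sup>+t. ennreal (w t * exp (- (t\<^sup>2 * 0\<^sup>2 / 2))) \<partial>lborel) = \<infinity>"
  proof (rule ccontr)
    let ?I = "\<integral>\<^sup>+t. ennreal (w t * exp (- (t\<^sup>2 * 0\<^sup>2 / 2))) \<partial>lborel"
    assume "?I \<noteq> \<infinity>"
    then obtain r where r: "?I = ennreal r" "r \<ge> 0" by (cases ?I) auto
    \<comment> \<open>The integral dominates \<open>A * \<bar>y\<bar> powr (- p)\<close> for every \<open>y \<noteq> 0\<close>, hence is infinite.\<close>
    define y where "y = ((r + 1) / A) powr (- 1 / p)"
    have y: "y > 0" using r A unfolding y_def by auto
    have "ennreal (A * \<bar>y\<bar> powr (- p)) \<le> ?I"
      using y w0 by (subst inner\<mu>[symmetric]) (auto intro!: nn_integral_mono ennreal_leI mult_left_le)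
    then have "A * \<bar>y\<bar> powr (- p) \<le> r" using r by (simp add: ennreal_le_iff)
    moreover have "\<bar>y\<bar> powr (- p) = (r + 1) / A"
      using y r A p by (simp add: y_def powr_powr)
    ultimately show False using A by simp
  qed
  have inner\<nu>: "(\<integral>\<^sup>+t. ennreal (w t * f (t * x)) \<partial>lborel) = ennreal (\<sigma> powr (- p) * B) * ennreal (\<bar>x\<bar> powr (- p))"
    if "x \<noteq> 0" for x
  proof -
    have "(\<integral>\<^sup>+t. ennreal (w t * f (t * x)) \<partial>lborel)
      = (\<integral>\<^sup>+t. ennreal (indicator {0<..} t * (t powr (p - 1) * exp (- ((\<sigma> * \<bar>x\<bar>) powr \<alpha> * t powr \<alpha>)))) \<partial>lborel)"
      using \<sigma> by (intro nn_integral_cong) (auto simp: w_def f_def indicator_def abs_mult powr_mult mult_ac)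
    also have "\<dots> = ennreal (((\<sigma> * \<bar>x\<bar>) powr \<alpha>) powr (- p / \<alpha>) * Gamma (p / \<alpha>) / \<alpha>)"
      using that p \<alpha> \<sigma> by (intro nn_integral_powr_exp_powr) auto
    also have "((\<sigma> * \<bar>x\<bar>) powr \<alpha>) powr (- p / \<alpha>) = \<sigma> powr (- p) * \<bar>x\<bar> powr (- p)"
      using \<alpha> \<sigma> by (simp add: powr_powr powr_mult)
    finally have "(\<integral>\<^sup>+t. ennreal (w t * f (t * x)) \<partial>lborel) = ennreal ((\<sigma> powr (- p) * B) * \<bar>x\<bar> powr (- p))"
      by (simp add: B_def mult_ac)
    then show ?thesis using B by (simp only: ennreal_mult powr_ge_zero mult_nonneg_nonneg less_imp_le)
  qed
  have total\<nu>: "(\<integral>\<^sup>+x. \<integral>\<^sup>+t. ennreal (w t * f (t * x)) \<partial>lborel \<partial>std_normal_distribution)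
     = ennreal (\<sigma> powr (- p) * B * G)"
  proof -
    have ae: "AE x in std_normal_distribution. x \<noteq> 0"
      using AE_lborel_singleton[of "0::real"] by (subst AE_density) auto
    have "(\<integral>\<^sup>+x. \<integral>\<^sup>+t. ennreal (w t * f (t * x)) \<partial>lborel \<partial>std_normal_distribution)
      = (\<integral>\<^sup>+x. ennreal (\<sigma> powr (- p) * B) * ennreal (\<bar>x\<bar> powr (- p)) \<partial>std_normal_distribution)"
      using ae by (intro nn_integral_cong_AE) (auto simp: inner\<nu>)
    also have "\<dots> = ennreal (\<sigma> powr (- p) * B) * (\<integral>\<^sup>+x. ennreal (\<bar>x\<bar> powr (- p)) \<partial>std_normal_distribution)"
      by (rule nn_integral_cmult) simp
    also have "\<dots> = ennreal (\<sigma> powr (- p) * B) * ennreal G"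
      unfolding G_def using nn_integral_std_normal_powr[OF p] by simp
    finally show ?thesis using B G by (simp add: ennreal_mult[symmetric])
  qed
  have "(\<integral>\<^sup>+y. \<integral>\<^sup>+t. ennreal (w t * exp (- (t\<^sup>2 * y\<^sup>2 / 2))) \<partial>lborel \<partial>\<mu>)
      = (\<integral>\<^sup>+t. \<integral>\<^sup>+y. ennreal (w t * exp (- (t\<^sup>2 * y\<^sup>2 / 2))) \<partial>\<mu> \<partial>lborel)"
    by (rule P1.Fubini') simp
  also have "\<dots> = (\<integral>\<^sup>+t. \<integral>\<^sup>+x. ennreal (w t * f (t * x)) \<partial>std_normal_distribution \<partial>lborel)"
  proof (intro nn_integral_cong)
    fix t
    have "(\<integral>\<^sup>+y. ennreal (w t * exp (- (t\<^sup>2 * y\<^sup>2 / 2))) \<partial>\<mu>)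
       = ennreal (w t) * (\<integral>\<^sup>+y. ennreal (exp (- (t\<^sup>2 * y\<^sup>2 / 2))) \<partial>\<mu>)"
      using w0 by (simp add: ennreal_mult nn_integral_cmult)
    also have "(\<integral>\<^sup>+y. ennreal (exp (- (t\<^sup>2 * y\<^sup>2 / 2))) \<partial>\<mu>) = (\<integral>\<^sup>+x. ennreal (f (t * x)) \<partial>std_normal_distribution)"
      by (rule nn_integral_exp_square_conv_char[OF \<mu> char]) (auto simp: f_def)
    also have "ennreal (w t) * \<dots> = (\<integral>\<^sup>+x. ennreal (w t * f (t * x)) \<partial>std_normal_distribution)"
      using w0 by (simp add: ennreal_mult nn_integral_cmult f_def)
    finally show "(\<integral>\<^sup>+y. ennreal (w t * exp (- (t\<^sup>2 * y\<^sup>2 / 2))) \<partial>\<mu>)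
        = (\<integral>\<^sup>+x. ennreal (w t * f (t * x)) \<partial>std_normal_distribution)" .
  qed
  also have "\<dots> = (\<integral>\<^sup>+x. \<integral>\<^sup>+t. ennreal (w t * f (t * x)) \<partial>lborel \<partial>std_normal_distribution)"
    by (rule P2.Fubini'[symmetric]) simp
  finally have total: "(\<integral>\<^sup>+y. \<integral>\<^sup>+t. ennreal (w t * exp (- (t\<^sup>2 * y\<^sup>2 / 2))) \<partial>lborel \<partial>\<mu>)
      = ennreal (\<sigma> powr (- p) * B * G)"
    using total\<nu> by simp
  have "AE y in \<mu>. (\<integral>\<^sup>+t. ennreal (w t * exp (- (t\<^sup>2 * y\<^sup>2 / 2))) \<partial>lborel) \<noteq> \<infinity>"
    by (rule nn_integral_PInf_AE) (auto simp: total)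
  then have ae\<mu>: "AE y in \<mu>. y \<noteq> 0"
    by eventually_elim (use inner0 in metis)
  have "ennreal A * (\<integral>\<^sup>+y. ennreal (\<bar>y\<bar> powr (- p)) \<partial>\<mu>) = (\<integral>\<^sup>+y. ennreal (A * \<bar>y\<bar> powr (- p)) \<partial>\<mu>)"
    using A by (simp add: ennreal_mult nn_integral_cmult)
  also have "\<dots> = ennreal (\<sigma> powr (- p) * B * G)"
    unfolding total[symmetric] using ae\<mu> by (intro nn_integral_cong_AE) (auto simp: inner\<mu>)
  also have "\<dots> = ennreal A * ennreal (\<sigma> powr (- p) * B * G / A)"
    using A B G by (subst ennreal_mult[symmetric]) auto
  finally have "(\<integral>\<^sup>+y. ennreal (\<bar>y\<bar> powr (- p)) \<partial>\<mu>) = ennreal (\<sigma> powr (- p) * B * G / A)"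
    using A by (simp add: ennreal_mult_cancel_left)
  also have "\<sigma> powr (- p) * B * G / A = neg_moment \<alpha> \<sigma> p"
  proof -
    have Gamma_Suc: "Gamma (1 + x) = x * Gamma x" if "x > 0" for x :: real
    proof -
      have "x \<notin> \<int>\<^sub>\<le>\<^sub>0" using that nonpos_Ints_nonpos[of x] by auto
      then show ?thesis using Gamma_plus1[of x] by (simp add: add.commute)
    qed
    have g1: "Gamma (1 + p / \<alpha>) = p * B"
      using p \<alpha> by (subst Gamma_Suc) (simp_all add: B_def)
    have g2: "Gamma (1 + p / 2) = p * (Gamma (p / 2) / 2)"
      using p by (subst Gamma_Suc) simp_all
    define c where "c = (2::real) powr (- p / 2)"
    have c: "c > 0" by (simp add: c_def)
    have half: "(1/2::real) powr (- p / 2) = 1 / c"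
      unfolding c_def by (subst powr_divide) simp_all
    have two: "(2::real) powr (- p) = c * c"
      unfolding c_def powr_add[symmetric] by simp
    define S where "S = \<sigma> powr (- p)"
    define g where "g = Gamma (p / 2)"
    have g: "g > 0" using p by (simp add: g_def)
    show ?thesis
      unfolding neg_moment_def g1 g2 G_def A_def half two c_def[symmetric] S_def[symmetric] g_def[symmetric]
      using p c g by (simp add: field_simps)
  qed
  also have "(\<integral>\<^sup>+y. ennreal (\<bar>y\<bar> powr (- p)) \<partial>\<mu>) = (\<integral>\<^sup>+\<omega>. ennreal (\<bar>Y \<omega>\<bar> powr (- p)) \<partial>M)"
    unfolding \<mu>_def by (rule nn_integral_distr) auto
  finally show "(\<integral>\<^sup>+\<omega>. ennreal (\<bar>Y \<omega>\<bar> powr (- p)) \<partial>M) = ennreal (neg_moment \<alpha> \<sigma> p)" .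
qed

lemma neg_moment_pos:
  assumes "\<alpha> > 0" "\<sigma> > 0" "0 < p" "p < 1"
  shows "neg_moment \<alpha> \<sigma> p > 0"
  using assms unfolding neg_moment_def
  by (intro divide_pos_pos mult_pos_pos Gamma_real_pos) (auto intro: add_pos_pos)

text \<open>The condition \<open>-1 < \<gamma>\<close> is applied to \<open>\<gamma>\<close> itself for the mean and to \<open>2 * \<gamma>\<close> for the second moment;
the latter is where the restriction \<open>\<gamma> > -1/2\<close> of the estimators comes from.\<close>

lemma
  assumes "prob_space M" "SaS_scale M \<alpha> \<sigma> Y" "\<alpha> > 0" "\<sigma> > 0" and p: "-1 < \<gamma>" "\<gamma> < 0"
  shows integrable_SaS_neg_powr: "integrable M (\<lambda>\<omega>. \<bar>Y \<omega>\<bar> powr \<gamma>)"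
    and expectation_SaS_neg_powr: "(\<integral>\<omega>. \<bar>Y \<omega>\<bar> powr \<gamma> \<partial>M) = neg_moment \<alpha> \<sigma> (- \<gamma>)"
proof -
  have [measurable]: "Y \<in> borel_measurable M" using assms by (simp add: SaS_scale_def)
  have nn: "(\<integral>\<^sup>+\<omega>. ennreal (\<bar>Y \<omega>\<bar> powr \<gamma>) \<partial>M) = ennreal (neg_moment \<alpha> \<sigma> (- \<gamma>))"
    using nn_integral_SaS_neg_powr[OF assms(1-4), of "- \<gamma>"] p by simp
  then show "integrable M (\<lambda>\<omega>. \<bar>Y \<omega>\<bar> powr \<gamma>)"
    by (intro integrableI_nn_integral_finite) auto
  have "neg_moment \<alpha> \<sigma> (- \<gamma>) > 0" using assms by (intro neg_moment_pos) auto
  then show "(\<integral>\<omega>. \<bar>Y \<omega>\<bar> powr \<gamma> \<partial>M) = neg_moment \<alpha> \<sigma> (- \<gamma>)"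
    using nn by (subst integral_eq_nn_integral) auto
qed

section \<open>Boundedness in probability\<close>

lemma (in prob_space) tail_small:
  fixes Y :: "'a \<Rightarrow> real"
  assumes [measurable]: "Y \<in> borel_measurable M" and "\<epsilon> > 0"
  shows "\<exists>B>0. \<forall>C\<ge>B. prob {\<omega> \<in> space M. \<bar>Y \<omega>\<bar> > C} \<le> \<epsilon>"
proof -
  define A where "A = (\<lambda>k. {\<omega> \<in> space M. \<bar>Y \<omega>\<bar> > real k})"
  have "(\<lambda>k. prob (A k)) \<longlonglongrightarrow> prob (\<Inter>k. A k)"
    by (intro finite_Lim_measure_decseq) (auto simp: A_def decseq_def)
  moreover have "(\<Inter>k. A k) = {}"
  proof -
    have "\<exists>k. \<not> \<bar>Y \<omega>\<bar> > real k" for \<omega>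
      using reals_Archimedean2[of "\<bar>Y \<omega>\<bar>"] by (metis less_asym)
    then show ?thesis by (auto simp: A_def)
  qed
  ultimately have "(\<lambda>k. prob (A k)) \<longlonglongrightarrow> 0" by simp
  then have "eventually (\<lambda>k. prob (A k) < \<epsilon>) sequentially"
    using \<open>\<epsilon> > 0\<close> by (rule order_tendstoD)
  then obtain k where k: "prob (A (Suc k)) < \<epsilon>"
    unfolding eventually_sequentially by (meson le_SucI order_refl)
  have "prob {\<omega> \<in> space M. \<bar>Y \<omega>\<bar> > C} \<le> \<epsilon>" if "C \<ge> real (Suc k)" for C
  proof -
    have "prob {\<omega> \<in> space M. \<bar>Y \<omega>\<bar> > C} \<le> prob (A (Suc k))"
      using that by (intro finite_measure_mono) (auto simp: A_def)
    with k show ?thesis by simp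
  qed
  then show ?thesis by (intro exI[of _ "real (Suc k)"]) auto
qed

text \<open>Any single random variable is tight, so only the tail of the sequence matters for stochastic
boundedness. This form, with an eventual bound and without the quotient sequence, is the one that is
convenient to establish and to combine.\<close>

lemma (in prob_space) bigo_in_prob_iff:
  assumes I: "I \<noteq> {}" and r: "\<And>n. r n > 0"
  shows "bigo_in_prob M I Y r \<longleftrightarrow> (\<forall>n\<in>I. Y n \<in> borel_measurable M) \<and>
    (\<forall>\<epsilon>>0. \<exists>B>0. \<forall>\<^sub>F n in sequentially. n \<in> I \<longrightarrow> prob {\<omega> \<in> space M. \<bar>Y n \<omega>\<bar> > B * r n} \<le> \<epsilon>)"
    (is "?L \<longleftrightarrow> ?meas \<and> ?R")
proof
  assume ?L
  then obtain Z where Z: "bounded_in_prob M I Z" and YZ: "\<And>n \<omega>. n \<in> I \<Longrightarrow> \<omega> \<in> space M \<Longrightarrow> Y n \<omega> = r n * Z n \<omega>"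
    unfolding bigo_in_prob_def by blast
  have mZ: "\<And>n. n \<in> I \<Longrightarrow> Z n \<in> borel_measurable M"
    using Z by (simp add: bounded_in_prob_def)
  have ?meas
  proof
    fix n assume n: "n \<in> I"
    have [measurable]: "Z n \<in> borel_measurable M" by (rule mZ[OF n])
    have "(\<lambda>\<omega>. r n * Z n \<omega>) \<in> borel_measurable M" by simp
    then show "Y n \<in> borel_measurable M"
      by (rule measurable_cong[THEN iffD2, rotated]) (use YZ n in auto)
  qed
  moreover have ?R
  proof (intro allI impI)
    fix \<epsilon> :: real assume "\<epsilon> > 0"
    then obtain B where B: "B > 0" "(SUP n\<in>I. prob {\<omega> \<in> space M. \<bar>Z n \<omega>\<bar> > B}) < \<epsilon>"
      using Z unfolding bounded_in_prob_def by blast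
    have "prob {\<omega> \<in> space M. \<bar>Y n \<omega>\<bar> > B * r n} \<le> \<epsilon>" if n: "n \<in> I" for n
    proof -
      have "{\<omega> \<in> space M. \<bar>Y n \<omega>\<bar> > B * r n} = {\<omega> \<in> space M. \<bar>Z n \<omega>\<bar> > B}"
        using r[of n] by (auto simp: YZ[OF n] abs_mult mult.commute)
      moreover have "prob {\<omega> \<in> space M. \<bar>Z n \<omega>\<bar> > B} \<le> (SUP n\<in>I. prob {\<omega> \<in> space M. \<bar>Z n \<omega>\<bar> > B})"
        using n by (intro cSUP_upper) (auto intro!: bdd_aboveI[of _ 1])
      ultimately show ?thesis using B by simp
    qed
    then show "\<exists>B>0. \<forall>\<^sub>F n in sequentially. n \<in> I \<longrightarrow> prob {\<omega> \<in> space M. \<bar>Y n \<omega>\<bar> > B * r n} \<le> \<epsilon>"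
      using B(1) by (intro exI[of _ B]) auto
  qed
  ultimately show "?meas \<and> ?R" ..
next
  assume "?meas \<and> ?R"
  then have meas: "\<And>n. n \<in> I \<Longrightarrow> Y n \<in> borel_measurable M" and R: ?R by auto
  define Z where "Z = (\<lambda>n \<omega>. Y n \<omega> / r n)"
  have mZ: "Z n \<in> borel_measurable M" if "n \<in> I" for n
    using meas[OF that] unfolding Z_def by simp
  have "bounded_in_prob M I Z"
    unfolding bounded_in_prob_def
  proof (intro conjI ballI allI impI mZ)
    fix \<epsilon> :: real assume \<epsilon>: "\<epsilon> > 0"
    define e where "e = \<epsilon> / 2"
    have e: "e > 0" "e < \<epsilon>" using \<epsilon> by (auto simp: e_def)
    from R e obtain B0 N where B0: "B0 > 0"
      and N: "\<And>n. n \<ge> N \<Longrightarrow> n \<in> I \<Longrightarrow> prob {\<omega> \<in> space M. \<bar>Y n \<omega>\<bar> > B0 * r n} \<le> e"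
      unfolding eventually_sequentially by meson
    have large: "prob {\<omega> \<in> space M. \<bar>Z n \<omega>\<bar> > B0} \<le> e" if "n \<ge> N" "n \<in> I" for n
    proof -
      have "{\<omega> \<in> space M. \<bar>Z n \<omega>\<bar> > B0} = {\<omega> \<in> space M. \<bar>Y n \<omega>\<bar> > B0 * r n}"
        using r[of n] by (auto simp: Z_def pos_less_divide_eq)
      then show ?thesis using N[OF that] by simp
    qed
    \<comment> \<open>The finitely many remaining indices are individually tight.\<close>
    have "\<exists>B>0. \<forall>C\<ge>B. prob {\<omega> \<in> space M. \<bar>Z n \<omega>\<bar> > C} \<le> e" if "n \<in> I" for n
      using mZ[OF that] e(1) by (rule tail_small)
    then obtain b where b: "\<And>n C. n \<in> I \<Longrightarrow> C \<ge> b n \<Longrightarrow> prob {\<omega> \<in> space M. \<bar>Z n \<omega>\<bar> > C} \<le> e"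
      by metis
    define B where "B = Max (insert B0 (b ` {..<N}))"
    have B: "B \<ge> B0" "\<And>n. n < N \<Longrightarrow> B \<ge> b n" by (auto simp: B_def)
    have "prob {\<omega> \<in> space M. \<bar>Z n \<omega>\<bar> > B} \<le> e" if n: "n \<in> I" for n
    proof (cases "n < N")
      case True
      then show ?thesis using b[OF n] B(2) by simp
    next
      case False
      have [measurable]: "Z n \<in> borel_measurable M" by (rule mZ[OF n])
      have "prob {\<omega> \<in> space M. \<bar>Z n \<omega>\<bar> > B} \<le> prob {\<omega> \<in> space M. \<bar>Z n \<omega>\<bar> > B0}"
        using B(1) by (intro finite_measure_mono) auto
      also have "\<dots> \<le> e" using False n by (intro large) auto
      finally show ?thesis .
    qed
    then have "(SUP n\<in>I. prob {\<omega> \<in> space M. \<bar>Z n \<omega>\<bar> > B}) \<le> e"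
      using I by (intro cSUP_least) auto
    then show "\<exists>B>0. (SUP n\<in>I. prob {\<omega> \<in> space M. \<bar>Z n \<omega>\<bar> > B}) < \<epsilon>"
      using B(1) B0 e by (intro exI[of _ B]) auto
  qed
  moreover have "Y n \<omega> = r n * Z n \<omega>" for n \<omega>
    using r[of n] by (simp add: Z_def)
  ultimately show ?L unfolding bigo_in_prob_def by blast
qed

text \<open>Chebyshev's inequality at level \<open>B * r n\<close> gives the bound \<open>D / B\<^sup>2\<close>, uniformly in \<open>n\<close>.\<close>

lemma (in prob_space) bigo_in_prob_second_moment:
  assumes I: "I \<noteq> {}" and r: "\<And>n. r n > 0"
    and meas: "\<And>n. n \<in> I \<Longrightarrow> Y n \<in> borel_measurable M"
    and int: "\<And>n. n \<in> I \<Longrightarrow> integrable M (\<lambda>\<omega>. (Y n \<omega>)\<^sup>2)"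
    and bound: "\<forall>\<^sub>F n in sequentially. n \<in> I \<longrightarrow> expectation (\<lambda>\<omega>. (Y n \<omega>)\<^sup>2) \<le> D * (r n)\<^sup>2"
  shows "bigo_in_prob M I Y r"
  unfolding bigo_in_prob_iff[OF I r]
proof (intro conjI ballI allI impI meas)
  fix \<epsilon> :: real assume \<epsilon>: "\<epsilon> > 0"
  define B where "B = sqrt ((\<bar>D\<bar> + 1) / \<epsilon>)"
  have B: "B > 0" "B\<^sup>2 = (\<bar>D\<bar> + 1) / \<epsilon>" using \<epsilon> by (auto simp: B_def)
  have "\<forall>\<^sub>F n in sequentially. n \<in> I \<longrightarrow> prob {\<omega> \<in> space M. \<bar>Y n \<omega>\<bar> > B * r n} \<le> \<epsilon>"
    using bound
  proof eventually_elim
    case (elim n)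
    show ?case
    proof
      assume n: "n \<in> I"
      have [measurable]: "Y n \<in> borel_measurable M" by (rule meas[OF n])
      have "prob {\<omega> \<in> space M. \<bar>Y n \<omega>\<bar> > B * r n} \<le> prob {\<omega> \<in> space M. \<bar>Y n \<omega>\<bar> \<ge> B * r n}"
        by (intro finite_measure_mono) auto
      also have "\<dots> \<le> expectation (\<lambda>\<omega>. (Y n \<omega>)\<^sup>2) / (B * r n)\<^sup>2"
        using r[of n] B(1) by (intro second_moment_method int n) auto
      also have "\<dots> \<le> (D * (r n)\<^sup>2) / (B * r n)\<^sup>2"
        using elim n by (intro divide_right_mono) auto
      also have "\<dots> = D / B\<^sup>2"
        using r[of n] by (simp add: power_mult_distrib)
      also have "\<dots> = D * \<epsilon> / (\<bar>D\<bar> + 1)" by (simp add: B(2))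
      also have "\<dots> \<le> \<epsilon>"
      proof -
        have "D * \<epsilon> \<le> \<epsilon> * (\<bar>D\<bar> + 1)"
          using \<epsilon> by (simp add: mult.commute[of D])
        then show ?thesis by (simp add: pos_divide_le_eq add_nonneg_pos)
      qed
      finally show "prob {\<omega> \<in> space M. \<bar>Y n \<omega>\<bar> > B * r n} \<le> \<epsilon>" .
    qed
  qed
  with B(1) show "\<exists>B>0. \<forall>\<^sub>F n in sequentially. n \<in> I \<longrightarrow> prob {\<omega> \<in> space M. \<bar>Y n \<omega>\<bar> > B * r n} \<le> \<epsilon>"
    by blast
qed

lemma (in prob_space) bigo_in_prob_imp_converges:
  assumes I: "I \<noteq> {}" and r: "\<And>n. r n > 0" "r \<longlonglongrightarrow> 0"
    and Y: "bigo_in_prob M I (\<lambda>n \<omega>. Y n \<omega> - c) r"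
  shows "converges_in_prob M I Y c"
  unfolding converges_in_prob_def
proof (intro conjI ballI allI impI)
  note iff = bigo_in_prob_iff[where Y = "\<lambda>n \<omega>. Y n \<omega> - c", OF I r(1), THEN iffD1, OF Y]
  show meas: "Y n \<in> borel_measurable M" if "n \<in> I" for n
  proof -
    have "(\<lambda>\<omega>. Y n \<omega> - c) \<in> borel_measurable M" using iff that by blast
    then have "(\<lambda>\<omega>. (Y n \<omega> - c) + c) \<in> borel_measurable M" by (intro borel_measurable_add) auto
    then show ?thesis by simp
  qed
  fix \<epsilon> :: real assume \<epsilon>: "\<epsilon> > 0"
  show "((\<lambda>n. prob {\<omega> \<in> space M. \<bar>Y n \<omega> - c\<bar> > \<epsilon>}) \<longlongrightarrow> 0) (inf sequentially (principal I))"
  proof (rule tendstoI)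
    fix e :: real assume "e > 0"
    then have "e / 2 > 0" by simp
    then obtain B where B: "B > 0"
      "\<forall>\<^sub>F n in sequentially. n \<in> I \<longrightarrow> prob {\<omega> \<in> space M. \<bar>Y n \<omega> - c\<bar> > B * r n} \<le> e / 2"
      using iff by blast
    have "\<forall>\<^sub>F n in sequentially. r n < \<epsilon> / B"
      using \<epsilon> B(1) r(2) by (intro order_tendstoD(2)[OF r(2)]) simp
    with B(2) have "\<forall>\<^sub>F n in sequentially. n \<in> I \<longrightarrow> dist (prob {\<omega> \<in> space M. \<bar>Y n \<omega> - c\<bar> > \<epsilon>}) 0 < e"
    proof eventually_elim
      case (elim n)
      show ?case
      proof
        assume n: "n \<in> I"
        have [measurable]: "Y n \<in> borel_measurable M" by (rule meas[OF n])
        have "B * r n \<le> \<epsilon>" using elim(2) B(1) by (simp add: pos_less_divide_eq mult.commute)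
        then have "prob {\<omega> \<in> space M. \<bar>Y n \<omega> - c\<bar> > \<epsilon>} \<le> prob {\<omega> \<in> space M. \<bar>Y n \<omega> - c\<bar> > B * r n}"
          by (intro finite_measure_mono) auto
        also have "\<dots> \<le> e / 2" using elim(1) n by blast
        finally show "dist (prob {\<omega> \<in> space M. \<bar>Y n \<omega> - c\<bar> > \<epsilon>}) 0 < e"
          using \<open>e > 0\<close> by simp
      qed
    qed
    then show "\<forall>\<^sub>F n in inf sequentially (principal I). dist (prob {\<omega> \<in> space M. \<bar>Y n \<omega> - c\<bar> > \<epsilon>}) 0 < e"
      by (simp add: eventually_inf_principal)
  qed
qed

lemma (in prob_space) bigo_in_prob_subset:
  assumes "I \<noteq> {}" "I \<subseteq> J" "\<And>n. r n > 0" "bigo_in_prob M J Y r"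
  shows "bigo_in_prob M I Y r"
proof -
  have "J \<noteq> {}" using assms by blast
  note J = bigo_in_prob_iff[OF this assms(3), THEN iffD1, OF assms(4)]
  show ?thesis
    unfolding bigo_in_prob_iff[OF assms(1,3)]
  proof (intro conjI ballI allI impI)
    fix \<epsilon> :: real assume "\<epsilon> > 0"
    then obtain B where "B > 0"
      "\<forall>\<^sub>F n in sequentially. n \<in> J \<longrightarrow> prob {\<omega> \<in> space M. \<bar>Y n \<omega>\<bar> > B * r n} \<le> \<epsilon>"
      using J by blast
    then show "\<exists>B>0. \<forall>\<^sub>F n in sequentially. n \<in> I \<longrightarrow> prob {\<omega> \<in> space M. \<bar>Y n \<omega>\<bar> > B * r n} \<le> \<epsilon>"
      using \<open>I \<subseteq> J\<close> by (intro exI[of _ B]) (auto elim: eventually_mono)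
  qed (use J \<open>I \<subseteq> J\<close> in blast)
qed

text \<open>For the half-sample statistic: the rate \<open>r (n div 2)\<close> that it inherits is no worse than \<open>r n\<close>.\<close>

lemma (in prob_space) bigo_in_prob_half:
  assumes I: "I \<noteq> {}" "\<And>n. n \<in> I \<Longrightarrow> n div 2 \<in> J" and r: "\<And>n. r n > 0"
    and O: "(\<lambda>n. r (n div 2)) \<in> O[inf sequentially (principal I)](r)"
    and Y: "bigo_in_prob M J Y r"
  shows "bigo_in_prob M I (\<lambda>n. Y (n div 2)) r"
proof -
  have J: "J \<noteq> {}" using I by blast
  note iff = bigo_in_prob_iff[OF J r, THEN iffD1, OF Y]
  from O obtain c where c: "c > 0"
    "\<forall>\<^sub>F n in inf sequentially (principal I). norm (r (n div 2)) \<le> c * norm (r n)"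
    by (rule landau_o.bigE)
  have c2: "\<forall>\<^sub>F n in sequentially. n \<in> I \<longrightarrow> r (n div 2) \<le> c * r n"
    using c(2) unfolding eventually_inf_principal
    by (rule eventually_mono) (use r in \<open>auto simp: abs_of_pos\<close>)
  have half: "filterlim (\<lambda>n::nat. n div 2) sequentially sequentially"
    unfolding filterlim_at_top
  proof
    fix Z :: nat
    show "\<forall>\<^sub>F n in sequentially. Z \<le> n div 2"
      using eventually_ge_at_top[of "2 * Z"] by eventually_elim auto
  qed
  show ?thesis
    unfolding bigo_in_prob_iff[OF I(1) r]
  proof (intro conjI ballI allI impI)
    show meas: "Y (n div 2) \<in> borel_measurable M" if "n \<in> I" for n
      using iff I(2)[OF that] by blast
    fix \<epsilon> :: real assume "\<epsilon> > 0"
    then obtain B where B: "B > 0"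
      "\<forall>\<^sub>F n in sequentially. n \<in> J \<longrightarrow> prob {\<omega> \<in> space M. \<bar>Y n \<omega>\<bar> > B * r n} \<le> \<epsilon>"
      using iff by blast
    have "\<forall>\<^sub>F n in sequentially. n div 2 \<in> J \<longrightarrow> prob {\<omega> \<in> space M. \<bar>Y (n div 2) \<omega>\<bar> > B * r (n div 2)} \<le> \<epsilon>"
      using half B(2) unfolding filterlim_iff by blast
    with c2 have "\<forall>\<^sub>F n in sequentially. n \<in> I \<longrightarrow> prob {\<omega> \<in> space M. \<bar>Y (n div 2) \<omega>\<bar> > (B * c) * r n} \<le> \<epsilon>"
    proof eventually_elim
      case (elim n)
      show ?case
      proof
        assume n: "n \<in> I"
        have [measurable]: "Y (n div 2) \<in> borel_measurable M" by (rule meas[OF n])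
        have "B * r (n div 2) \<le> B * (c * r n)"
          using elim(1) n B(1) by (intro mult_left_mono) auto
        then have "prob {\<omega> \<in> space M. \<bar>Y (n div 2) \<omega>\<bar> > (B * c) * r n}
            \<le> prob {\<omega> \<in> space M. \<bar>Y (n div 2) \<omega>\<bar> > B * r (n div 2)}"
          by (intro finite_measure_mono) (auto simp: mult.assoc)
        also have "\<dots> \<le> \<epsilon>" using elim(2) I(2)[OF n] by blast
        finally show "prob {\<omega> \<in> space M. \<bar>Y (n div 2) \<omega>\<bar> > (B * c) * r n} \<le> \<epsilon>" .
      qed
    qed
    moreover have "B * c > 0" using B(1) c(1) by simp
    ultimately show "\<exists>B>0. \<forall>\<^sub>F n in sequentially. n \<in> I \<longrightarrow> prob {\<omega> \<in> space M. \<bar>Y (n div 2) \<omega>\<bar> > B * r n} \<le> \<epsilon>"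
      by blast
  qed
qed

lemma differentiable_imp_locally_Lipschitz_at:
  fixes g :: "real \<times> real \<Rightarrow> real"
  assumes "g differentiable (at (c1, c2))"
  obtains \<delta> l where "\<delta> > 0" "l > 0"
    "\<And>x y. \<bar>x - c1\<bar> < \<delta> \<Longrightarrow> \<bar>y - c2\<bar> < \<delta> \<Longrightarrow> \<bar>g (x, y) - g (c1, c2)\<bar> \<le> l * (\<bar>x - c1\<bar> + \<bar>y - c2\<bar>)"
proof -
  from assms obtain g' where g': "(g has_derivative g') (at (c1, c2))"
    unfolding differentiable_def by blast
  then have lin: "bounded_linear g'" by (rule has_derivative_bounded_linear)
  from lin obtain k where k: "k > 0" "\<And>z. norm (g' z) \<le> norm z * k"
    using bounded_linear.pos_bounded by blast
  have "\<forall>e>0. \<exists>d>0. \<forall>z. norm (z - (c1, c2)) < d \<longrightarrow>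
      norm (g z - g (c1, c2) - g' (z - (c1, c2))) \<le> e * norm (z - (c1, c2))"
    using g' unfolding has_derivative_at_alt by blast
  from this[rule_format, of 1] obtain d where d: "d > 0"
    "\<And>z. norm (z - (c1, c2)) < d \<Longrightarrow> norm (g z - g (c1, c2) - g' (z - (c1, c2))) \<le> norm (z - (c1, c2))"
    by auto
  show thesis
  proof (rule that[of "d / 2" "k + 1"])
    fix x y assume xy: "\<bar>x - c1\<bar> < d / 2" "\<bar>y - c2\<bar> < d / 2"
    define w where "w = (x, y) - (c1, c2)"
    have w: "norm w \<le> \<bar>x - c1\<bar> + \<bar>y - c2\<bar>"
      unfolding w_def using norm_Pair_le[of "x - c1" "y - c2"] by simp
    then have "norm w < d" using xy by simp
    then have "norm (g (x, y) - g (c1, c2) - g' w) \<le> norm w"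
      unfolding w_def by (rule d(2))
    then have "\<bar>g (x, y) - g (c1, c2)\<bar> \<le> norm w + norm (g' w)"
      by (simp add: abs_le_iff) linarith
    also have "\<dots> \<le> (k + 1) * norm w" using k(2)[of w] by (simp add: algebra_simps)
    also have "\<dots> \<le> (k + 1) * (\<bar>x - c1\<bar> + \<bar>y - c2\<bar>)"
      using w k(1) by (intro mult_left_mono) auto
    finally show "\<bar>g (x, y) - g (c1, c2)\<bar> \<le> (k + 1) * (\<bar>x - c1\<bar> + \<bar>y - c2\<bar>)" .
  qed (use d(1) k(1) in auto)
qed

text \<open>The delta method. A function that is differentiable at \<open>(c1, c2)\<close> grows at most linearly around that
point, and because \<open>r\<close> tends to zero the arguments eventually lie in the region where this linear bound
holds, except on an event of small probability. Default values of \<open>ln\<close> and \<open>phi\<close> outside their natural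
domains are confined to that event.\<close>

lemma (in prob_space) bigo_in_prob_delta_method:
  fixes g :: "real \<times> real \<Rightarrow> real"
  assumes I: "I \<noteq> {}" and r: "\<And>n. r n > 0" "r \<longlonglongrightarrow> 0"
    and Y1: "bigo_in_prob M I (\<lambda>n \<omega>. Y1 n \<omega> - c1) r"
    and Y2: "bigo_in_prob M I (\<lambda>n \<omega>. Y2 n \<omega> - c2) r"
    and g: "g differentiable (at (c1, c2))"
    and meas: "\<And>n. n \<in> I \<Longrightarrow> (\<lambda>\<omega>. g (Y1 n \<omega>, Y2 n \<omega>)) \<in> borel_measurable M"
  shows "bigo_in_prob M I (\<lambda>n \<omega>. g (Y1 n \<omega>, Y2 n \<omega>) - g (c1, c2)) r"
proof -
  note iff1 = bigo_in_prob_iff[where Y = "\<lambda>n \<omega>. Y1 n \<omega> - c1", OF I r(1), THEN iffD1, OF Y1]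
  note iff2 = bigo_in_prob_iff[where Y = "\<lambda>n \<omega>. Y2 n \<omega> - c2", OF I r(1), THEN iffD1, OF Y2]
  obtain \<delta> l where \<delta>: "\<delta> > 0" and l: "l > 0"
    and lip: "\<And>x y. \<bar>x - c1\<bar> < \<delta> \<Longrightarrow> \<bar>y - c2\<bar> < \<delta> \<Longrightarrow> \<bar>g (x, y) - g (c1, c2)\<bar> \<le> l * (\<bar>x - c1\<bar> + \<bar>y - c2\<bar>)"
    using differentiable_imp_locally_Lipschitz_at[OF g] by blast
  show ?thesis
    unfolding bigo_in_prob_iff[where Y = "\<lambda>n \<omega>. g (Y1 n \<omega>, Y2 n \<omega>) - g (c1, c2)", OF I r(1)]
  proof (intro conjI ballI allI impI)
    show "(\<lambda>\<omega>. g (Y1 n \<omega>, Y2 n \<omega>) - g (c1, c2)) \<in> borel_measurable M" if "n \<in> I" for n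
      using meas[OF that] by (intro borel_measurable_diff) auto
    fix \<epsilon> :: real assume "\<epsilon> > 0"
    then have e: "\<epsilon> / 2 > 0" by simp
    obtain B1 where B1: "B1 > 0"
      "\<forall>\<^sub>F n in sequentially. n \<in> I \<longrightarrow> prob {\<omega> \<in> space M. \<bar>Y1 n \<omega> - c1\<bar> > B1 * r n} \<le> \<epsilon> / 2"
      using iff1 e by blast
    obtain B2 where B2: "B2 > 0"
      "\<forall>\<^sub>F n in sequentially. n \<in> I \<longrightarrow> prob {\<omega> \<in> space M. \<bar>Y2 n \<omega> - c2\<bar> > B2 * r n} \<le> \<epsilon> / 2"
      using iff2 e by blast
    define B where "B = l * (B1 + B2)"
    have "\<forall>\<^sub>F n in sequentially. r n < \<delta> / B1" "\<forall>\<^sub>F n in sequentially. r n < \<delta> / B2"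
      using \<delta> B1(1) B2(1) by (auto intro!: order_tendstoD(2)[OF r(2)])
    with B1(2) B2(2)
    have "\<forall>\<^sub>F n in sequentially. n \<in> I \<longrightarrow> prob {\<omega> \<in> space M. \<bar>g (Y1 n \<omega>, Y2 n \<omega>) - g (c1, c2)\<bar> > B * r n} \<le> \<epsilon>"
    proof eventually_elim
      case (elim n)
      show ?case
      proof
        assume n: "n \<in> I"
        have m1[measurable]: "(\<lambda>\<omega>. Y1 n \<omega> - c1) \<in> borel_measurable M"
          and m2[measurable]: "(\<lambda>\<omega>. Y2 n \<omega> - c2) \<in> borel_measurable M"
          using iff1 iff2 n by blast+
        have s1: "B1 * r n < \<delta>" and s2: "B2 * r n < \<delta>"
          using elim B1(1) B2(1) by (simp_all add: pos_less_divide_eq mult.commute)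
        let ?A1 = "{\<omega> \<in> space M. \<bar>Y1 n \<omega> - c1\<bar> > B1 * r n}"
        let ?A2 = "{\<omega> \<in> space M. \<bar>Y2 n \<omega> - c2\<bar> > B2 * r n}"
        have "{\<omega> \<in> space M. \<bar>g (Y1 n \<omega>, Y2 n \<omega>) - g (c1, c2)\<bar> > B * r n} \<subseteq> ?A1 \<union> ?A2"
        proof (rule subsetI, rule ccontr)
          fix \<omega> assume \<omega>: "\<omega> \<in> {\<omega> \<in> space M. \<bar>g (Y1 n \<omega>, Y2 n \<omega>) - g (c1, c2)\<bar> > B * r n}" "\<omega> \<notin> ?A1 \<union> ?A2"
          then have le: "\<bar>Y1 n \<omega> - c1\<bar> \<le> B1 * r n" "\<bar>Y2 n \<omega> - c2\<bar> \<le> B2 * r n" by auto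
          then have "\<bar>g (Y1 n \<omega>, Y2 n \<omega>) - g (c1, c2)\<bar> \<le> l * (\<bar>Y1 n \<omega> - c1\<bar> + \<bar>Y2 n \<omega> - c2\<bar>)"
            using s1 s2 by (intro lip) auto
          also have "\<dots> \<le> l * (B1 * r n + B2 * r n)"
            using le l by (intro mult_left_mono add_mono) auto
          also have "\<dots> = B * r n" by (simp add: B_def algebra_simps)
          finally show False using \<omega>(1) by simp
        qed
        then have "prob {\<omega> \<in> space M. \<bar>g (Y1 n \<omega>, Y2 n \<omega>) - g (c1, c2)\<bar> > B * r n} \<le> prob (?A1 \<union> ?A2)"
          by (intro finite_measure_mono) auto
        also have "\<dots> \<le> prob ?A1 + prob ?A2"
          by (intro measure_Un_le) auto
        also have "\<dots> \<le> \<epsilon> / 2 + \<epsilon> / 2"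
          using elim(1,2) n by (intro add_mono) auto
        finally show "prob {\<omega> \<in> space M. \<bar>g (Y1 n \<omega>, Y2 n \<omega>) - g (c1, c2)\<bar> > B * r n} \<le> \<epsilon>" by simp
      qed
    qed
    moreover have "B > 0" using l B1(1) B2(1) by (simp add: B_def)
    ultimately show "\<exists>B>0. \<forall>\<^sub>F n in sequentially. n \<in> I \<longrightarrow>
        prob {\<omega> \<in> space M. \<bar>g (Y1 n \<omega>, Y2 n \<omega>) - g (c1, c2)\<bar> > B * r n} \<le> \<epsilon>"
      by blast
  qed
qed

section \<open>Second moments of the power variations\<close>

lemma fdd_eq_distr:
  assumes "fdd_eq M Y Z" and "finite T"
    and [measurable]: "\<And>t. Y t \<in> borel_measurable M" "\<And>t. Z t \<in> borel_measurable M"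
    and F: "F \<in> measurable (\<Pi>\<^sub>M t\<in>T. borel) N"
  shows "distr M N (\<lambda>\<omega>. F (\<lambda>t\<in>T. Y t \<omega>)) = distr M N (\<lambda>\<omega>. F (\<lambda>t\<in>T. Z t \<omega>))"
proof -
  have "distr M N (\<lambda>\<omega>. F (\<lambda>t\<in>T. U t \<omega>)) = distr (distr M (\<Pi>\<^sub>M t\<in>T. borel) (\<lambda>\<omega>. \<lambda>t\<in>T. U t \<omega>)) N F"
    if "\<And>t. U t \<in> borel_measurable M" for U :: "real \<Rightarrow> 'a \<Rightarrow> real"
    using that F by (subst distr_distr) (auto simp: comp_def intro!: measurable_restrict)
  then show ?thesis using assms unfolding fdd_eq_def by metis
qed

text \<open>Increments are linear functionals of finitely many values of the process. Covariances only involve two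
of them at a time, so equality of the joint law of two functionals is all that is extracted from
equality of the finite-dimensional distributions.\<close>

lemma fdd_eq_linear_pair:
  fixes u v :: "nat \<Rightarrow> real"
  assumes "fdd_eq M Y Z"
    and "\<And>t. Y t \<in> borel_measurable M" "\<And>t. Z t \<in> borel_measurable M"
  shows "distr M (borel \<Otimes>\<^sub>M borel) (\<lambda>\<omega>. (\<Sum>k\<le>K. c k * Y (u k) \<omega>, \<Sum>k\<le>K. c k * Y (v k) \<omega>))
       = distr M (borel \<Otimes>\<^sub>M borel) (\<lambda>\<omega>. (\<Sum>k\<le>K. c k * Z (u k) \<omega>, \<Sum>k\<le>K. c k * Z (v k) \<omega> :: real))"
proof -
  define T where "T = u ` {..K} \<union> v ` {..K}"
  define F where "F = (\<lambda>z :: real \<Rightarrow> real. (\<Sum>k\<le>K. c k * z (u k), \<Sum>k\<le>K. c k * z (v k)))"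
  have "(\<lambda>z. z (u k)) \<in> borel_measurable (\<Pi>\<^sub>M t\<in>T. borel)"
    "(\<lambda>z. z (v k)) \<in> borel_measurable (\<Pi>\<^sub>M t\<in>T. borel)" if "k \<in> {..K}" for k
    using that by (auto intro!: measurable_component_singleton simp: T_def)
  then have "F \<in> measurable (\<Pi>\<^sub>M t\<in>T. borel) (borel \<Otimes>\<^sub>M borel)"
    unfolding F_def by (intro measurable_Pair borel_measurable_sum borel_measurable_times borel_measurable_const)
  moreover have "finite T" by (simp add: T_def)
  ultimately have "distr M (borel \<Otimes>\<^sub>M borel) (\<lambda>\<omega>. F (\<lambda>t\<in>T. Y t \<omega>)) = distr M (borel \<Otimes>\<^sub>M borel) (\<lambda>\<omega>. F (\<lambda>t\<in>T. Z t \<omega>))"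
    using assms by (intro fdd_eq_distr)
  moreover have "F (\<lambda>t\<in>T. U t \<omega>) = (\<Sum>k\<le>K. c k * U (u k) \<omega>, \<Sum>k\<le>K. c k * U (v k) \<omega>)"
    for U :: "real \<Rightarrow> 'a \<Rightarrow> real" and \<omega>
    unfolding F_def by (auto simp: T_def intro!: sum.cong)
  ultimately show ?thesis by simp
qed

lemma measurable_incr:
  assumes "real_process M X"
  shows "incr K a X p n \<in> borel_measurable M"
proof -
  have [measurable]: "X t \<in> borel_measurable M" for t
    using assms by (simp add: real_process_def)
  have "incr K a X p n = (\<lambda>\<omega>. \<Sum>k\<le>K. a k * X (real_of_int (int k + p) / real n) \<omega>)"
    by (simp add: incr_def fun_eq_iff)
  then show ?thesis by simp
qed

text \<open>Shifting time by \<open>q / n\<close> moves the second increment to the origin. The shift only preserves the law of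
\<open>X\<close> up to subtracting its value at one time, which the increments do not see as their coefficients sum
to zero. Rescaling time by \<open>n\<close> then contributes the factor \<open>n powr H\<close>.\<close>

lemma distr_incr_pair:
  assumes X: "real_process M X" and ss: "self_similar M H X" and si: "stationary_increments M X"
    and a0: "(\<Sum>k\<le>K. a k) = 0" and n: "n > 0"
  shows "distr M (borel \<Otimes>\<^sub>M borel)
           (\<lambda>\<omega>. (real n powr H * incr K a X p n \<omega>, real n powr H * incr K a X q n \<omega>))
       = distr M (borel \<Otimes>\<^sub>M borel) (\<lambda>\<omega>. (incr K a X (p - q) 1 \<omega>, incr K a X 0 1 \<omega>))"
proof -
  have [measurable]: "X t \<in> borel_measurable M" for t
    using X by (simp add: real_process_def)
  define c where "c = (\<lambda>k. real n powr H * a k)"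
  have sumc: "(\<Sum>k\<le>K. c k * (x k - y)) = (\<Sum>k\<le>K. c k * x k)" for x y
  proof -
    have "(\<Sum>k\<le>K. c k * (x k - y)) = (\<Sum>k\<le>K. c k * x k) - (\<Sum>k\<le>K. real n powr H * y * a k)"
      unfolding sum_subtractf[symmetric] by (intro sum.cong) (simp_all add: c_def algebra_simps)
    then show ?thesis by (simp add: sum_distrib_left[symmetric] a0)
  qed
  have incr: "(\<Sum>k\<le>K. c k * X ((real k + of_int r) / real n) \<omega>) = real n powr H * incr K a X r n \<omega>" for r \<omega>
    by (simp add: incr_def c_def sum_distrib_left mult_ac)
  define s where "s = of_int q / real n"
  define u where "u = (\<lambda>k::nat. (real k + of_int (p - q)) / real n)"
  define v where "v = (\<lambda>k::nat. (real k + of_int 0) / real n)"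
  have us: "u k + s = (real k + of_int p) / real n" and vs: "v k + s = (real k + of_int q) / real n" for k
    by (simp_all add: u_def v_def s_def add_divide_distrib[symmetric])
  have "distr M (borel \<Otimes>\<^sub>M borel)
          (\<lambda>\<omega>. (\<Sum>k\<le>K. c k * (X (u k + s) \<omega> - X s \<omega>), \<Sum>k\<le>K. c k * (X (v k + s) \<omega> - X s \<omega>)))
      = distr M (borel \<Otimes>\<^sub>M borel)
          (\<lambda>\<omega>. (\<Sum>k\<le>K. c k * (X (u k) \<omega> - X 0 \<omega>), \<Sum>k\<le>K. c k * (X (v k) \<omega> - X 0 \<omega>)))"
    using si unfolding stationary_increments_def by (intro fdd_eq_linear_pair) auto
  then have stat: "distr M (borel \<Otimes>\<^sub>M borel)
           (\<lambda>\<omega>. (real n powr H * incr K a X p n \<omega>, real n powr H * incr K a X q n \<omega>))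
      = distr M (borel \<Otimes>\<^sub>M borel)
          (\<lambda>\<omega>. (\<Sum>k\<le>K. c k * X (u k) \<omega>, \<Sum>k\<le>K. c k * X (v k) \<omega>))"
    unfolding sumc us vs incr .
  define u' where "u' = (\<lambda>k::nat. real k + of_int (p - q))"
  have un: "u k = 1 / real n * u' k" and vn: "v k = 1 / real n * real k" for k
    by (simp_all add: u_def v_def u'_def)
  have "distr M (borel \<Otimes>\<^sub>M borel)
          (\<lambda>\<omega>. (\<Sum>k\<le>K. c k * X (1 / real n * u' k) \<omega>, \<Sum>k\<le>K. c k * X (1 / real n * real k) \<omega>))
      = distr M (borel \<Otimes>\<^sub>M borel)
          (\<lambda>\<omega>. (\<Sum>k\<le>K. c k * ((1 / real n) powr H * X (u' k) \<omega>), \<Sum>k\<le>K. c k * ((1 / real n) powr H * X (real k) \<omega>)))"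
  proof (rule fdd_eq_linear_pair[where Y = "\<lambda>t. X (1 / real n * t)" and Z = "\<lambda>t \<omega>. (1 / real n) powr H * X t \<omega>"])
    have "0 < 1 / real n" using n by simp
    then show "fdd_eq M (\<lambda>t. X (1 / real n * t)) (\<lambda>t \<omega>. (1 / real n) powr H * X t \<omega>)"
      using ss unfolding self_similar_def by blast
  qed simp_all
  moreover have "c k * ((1 / real n) powr H * x) = a k * x" for k x
  proof -
    have "real n powr H * (1 / real n) powr H = 1"
      using n by (subst powr_mult[symmetric]) auto
    moreover have "c k * ((1 / real n) powr H * x) = (real n powr H * (1 / real n) powr H) * (a k * x)"
      by (simp only: c_def mult_ac)
    ultimately show ?thesis by simp
  qed
  ultimately show ?thesis
    unfolding stat un vn by (simp add: incr_def u'_def)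
qed

text \<open>The second moment of the average is \<open>1 / N\<^sup>2\<close> times a sum of \<open>N\<^sup>2\<close> covariances. Each row of this Toeplitz
array runs through distinct lags between \<open>- n\<close> and \<open>n\<close>, so it is at most the sum of all \<open>\<bar>c k\<bar>\<close>, which
saves one factor \<open>N\<close>.\<close>

lemma (in prob_space)
  fixes Z :: "nat \<Rightarrow> 'a \<Rightarrow> real" and c :: "int \<Rightarrow> real"
  assumes N: "N > 0" "N \<le> n + 1"
    and int: "\<And>p q. p < N \<Longrightarrow> q < N \<Longrightarrow> integrable M (\<lambda>\<omega>. (Z p \<omega> - m) * (Z q \<omega> - m))"
    and cov: "\<And>p q. p < N \<Longrightarrow> q < N \<Longrightarrow> expectation (\<lambda>\<omega>. (Z p \<omega> - m) * (Z q \<omega> - m)) = c (int p - int q)"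
  shows integrable_average_square: "integrable M (\<lambda>\<omega>. (1 / real N * (\<Sum>p<N. Z p \<omega>) - m)\<^sup>2)"
    and average_second_moment_le:
      "expectation (\<lambda>\<omega>. (1 / real N * (\<Sum>p<N. Z p \<omega>) - m)\<^sup>2) \<le> 1 / real N * (\<Sum>k=-int n..int n. \<bar>c k\<bar>)"
proof -
  have sq: "(1 / real N * (\<Sum>p<N. Z p \<omega>) - m)\<^sup>2 = 1 / (real N)\<^sup>2 * (\<Sum>p<N. \<Sum>q<N. (Z p \<omega> - m) * (Z q \<omega> - m))" for \<omega>
  proof -
    have "1 / real N * (\<Sum>p<N. Z p \<omega>) - m = 1 / real N * (\<Sum>p<N. Z p \<omega> - m)"
      using N by (simp add: sum_subtractf field_simps)
    then show ?thesis
      by (simp add: power_mult_distrib power_divide) (simp add: power2_eq_square sum_product)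
  qed
  show "integrable M (\<lambda>\<omega>. (1 / real N * (\<Sum>p<N. Z p \<omega>) - m)\<^sup>2)"
    unfolding sq using int by (intro integrable_mult_right Bochner_Integration.integrable_sum) auto
  have row: "(\<Sum>p<N. c (int p - int q)) \<le> (\<Sum>k=-int n..int n. \<bar>c k\<bar>)" if "q < N" for q
  proof -
    have "(\<Sum>p<N. c (int p - int q)) \<le> (\<Sum>p<N. \<bar>c (int p - int q)\<bar>)"
      by (intro sum_mono) simp
    also have "\<dots> = (\<Sum>k\<in>(\<lambda>p. int p - int q) ` {..<N}. \<bar>c k\<bar>)"
      by (subst sum.reindex) (auto simp: inj_on_def)
    also have "\<dots> \<le> (\<Sum>k=-int n..int n. \<bar>c k\<bar>)"
      using that N by (intro sum_mono2) auto
    finally show ?thesis .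
  qed
  have "expectation (\<lambda>\<omega>. (1 / real N * (\<Sum>p<N. Z p \<omega>) - m)\<^sup>2)
      = 1 / (real N)\<^sup>2 * (\<Sum>p<N. \<Sum>q<N. c (int p - int q))"
  proof -
    have "expectation (\<lambda>\<omega>. \<Sum>p<N. \<Sum>q<N. (Z p \<omega> - m) * (Z q \<omega> - m))
        = (\<Sum>p<N. \<Sum>q<N. expectation (\<lambda>\<omega>. (Z p \<omega> - m) * (Z q \<omega> - m)))"
      using int by (subst Bochner_Integration.integral_sum)
        (auto intro!: sum.cong Bochner_Integration.integrable_sum Bochner_Integration.integral_sum)
    also have "\<dots> = (\<Sum>p<N. \<Sum>q<N. c (int p - int q))"
      using cov by (intro sum.cong) auto
    finally show ?thesis unfolding sq by simp
  qed
  also have "(\<Sum>p<N. \<Sum>q<N. c (int p - int q)) = (\<Sum>q<N. \<Sum>p<N. c (int p - int q))"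
    by (rule sum.swap)
  also have "1 / (real N)\<^sup>2 * \<dots> \<le> 1 / (real N)\<^sup>2 * (\<Sum>q<N. \<Sum>k=-int n..int n. \<bar>c k\<bar>)"
    using row by (intro mult_left_mono sum_mono) auto
  also have "\<dots> = 1 / real N * (\<Sum>k=-int n..int n. \<bar>c k\<bar>)"
    using N by (simp add: power2_eq_square)
  finally show "expectation (\<lambda>\<omega>. (1 / real N * (\<Sum>p<N. Z p \<omega>) - m)\<^sup>2) \<le> 1 / real N * (\<Sum>k=-int n..int n. \<bar>c k\<bar>)" .
qed

text \<open>The normalisation \<open>n powr (\<gamma> * H)\<close> in \<open>W\<close> is exactly what rescales every increment to unit time step, so
\<open>W\<close> is an average of identically distributed terms.\<close>

lemma W_eq_average:
  assumes "K \<le> n" "n > 0"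
  shows "W K a X H \<gamma> n \<omega>
     = 1 / real (n - K + 1) * (\<Sum>p<n - K + 1. \<bar>real n powr H * incr K a X (int p) n \<omega>\<bar> powr \<gamma>)"
proof -
  have set: "{0..int n - int K} = int ` {..<n - K + 1}"
  proof (intro equalityI subsetI)
    fix x assume "x \<in> {0..int n - int K}"
    then have "x = int (nat x)" "nat x \<in> {..<n - K + 1}" using assms by auto
    then show "x \<in> int ` {..<n - K + 1}" by blast
  qed (use assms in auto)
  have sum: "(\<Sum>p=0..int n - int K. f p) = (\<Sum>p<n - K + 1. f (int p))" for f :: "int \<Rightarrow> real"
    unfolding set by (subst sum.reindex) auto
  have abs: "\<bar>real n powr H * x\<bar> powr \<gamma> = real n powr (\<gamma> * H) * \<bar>x\<bar> powr \<gamma>" for x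
    by (simp add: abs_mult powr_mult powr_powr mult.commute)
  have "real (n - K + 1) = real n - real K + 1"
    using assms by (simp add: of_nat_diff)
  then show ?thesis
    unfolding W_def V_def sum abs sum_distrib_left[symmetric] by simp
qed

lemma integrable_mult_of_squares:
  fixes f g :: "'a \<Rightarrow> real"
  assumes [measurable]: "f \<in> borel_measurable M" "g \<in> borel_measurable M"
    and "integrable M (\<lambda>x. (f x)\<^sup>2)" "integrable M (\<lambda>x. (g x)\<^sup>2)"
  shows "integrable M (\<lambda>x. f x * g x)"
proof (rule Bochner_Integration.integrable_bound)
  show "integrable M (\<lambda>x. (f x)\<^sup>2 + (g x)\<^sup>2)" using assms by simp
  have "\<bar>s * t\<bar> \<le> s\<^sup>2 + t\<^sup>2" for s t :: real
  proof -
    have "2 * (\<bar>s\<bar> * \<bar>t\<bar>) \<le> \<bar>s\<bar>\<^sup>2 + \<bar>t\<bar>\<^sup>2"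
      using sum_squares_bound[of "\<bar>s\<bar>" "\<bar>t\<bar>"] by (simp add: mult.assoc)
    moreover have "0 \<le> \<bar>s\<bar> * \<bar>t\<bar>" by simp
    ultimately have "\<bar>s\<bar> * \<bar>t\<bar> \<le> \<bar>s\<bar>\<^sup>2 + \<bar>t\<bar>\<^sup>2" by linarith
    then show ?thesis by (simp add: abs_mult)
  qed
  then show "AE x in M. norm (f x * g x) \<le> norm ((f x)\<^sup>2 + (g x)\<^sup>2)" by simp
qed simp

lemma measurable_W:
  assumes "real_process M X"
  shows "W K a X H \<gamma> n \<in> borel_measurable M"
proof -
  note [measurable] = measurable_incr[OF assms]
  have "W K a X H \<gamma> n = (\<lambda>\<omega>. real n powr (\<gamma> * H) * (1 / (real n - real K + 1) *
      (\<Sum>p = 0..int n - int K. \<bar>incr K a X p n \<omega>\<bar> powr \<gamma>)))"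
    by (simp add: W_def V_def fun_eq_iff)
  then show ?thesis by simp
qed

text \<open>\<open>W\<close> averages the variables \<open>\<bar>n powr H * incr K a X p n\<bar> powr \<gamma>\<close>. Their means all equal the stable moment,
and their covariances are those of the unit-step increments at lag \<open>p - q\<close>.\<close>

lemma (in prob_space)
  assumes X: "real_process M X" "self_similar M H X" "stationary_increments M X"
    and a: "(\<Sum>k\<le>K. a k) = 0" and n: "K \<ge> 1" "n \<ge> K"
    and Y: "SaS_scale M \<alpha> \<sigma> (incr K a X 0 1)" "\<alpha> > 0" "\<sigma> > 0"
    and \<gamma>: "- 1/2 < \<gamma>" "\<gamma> < 0"
  shows integrable_W_square: "integrable M (\<lambda>\<omega>. (W K a X H \<gamma> n \<omega> - neg_moment \<alpha> \<sigma> (- \<gamma>))\<^sup>2)"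
    and W_second_moment_le: "expectation (\<lambda>\<omega>. (W K a X H \<gamma> n \<omega> - neg_moment \<alpha> \<sigma> (- \<gamma>))\<^sup>2)
      \<le> 1 / real (n - K + 1) * (\<Sum>k = - int n..int n.
          \<bar>covariance M (\<lambda>\<omega>. \<bar>incr K a X k 1 \<omega>\<bar> powr \<gamma>) (\<lambda>\<omega>. \<bar>incr K a X 0 1 \<omega>\<bar> powr \<gamma>)\<bar>)"
proof -
  define m where "m = neg_moment \<alpha> \<sigma> (- \<gamma>)"
  define Z where "Z = (\<lambda>l p \<omega>. \<bar>real l powr H * incr K a X p l \<omega>\<bar> powr \<gamma>)"
  note [measurable] = measurable_incr[OF X(1)]
  have [measurable]: "Z l p \<in> borel_measurable M" for l p unfolding Z_def by simp
  have Z1: "Z (Suc 0) k = (\<lambda>\<omega>. \<bar>incr K a X k 1 \<omega>\<bar> powr \<gamma>)" for k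
    by (simp add: Z_def fun_eq_iff)
  \<comment> \<open>Any statistic of two rescaled increments may be computed at unit time step.\<close>
  have transfer: "integrable M (\<lambda>\<omega>. F (Z l p \<omega>, Z l q \<omega>)) \<longleftrightarrow> integrable M (\<lambda>\<omega>. F (Z (Suc 0) (p - q) \<omega>, Z (Suc 0) 0 \<omega>))"
    "expectation (\<lambda>\<omega>. F (Z l p \<omega>, Z l q \<omega>)) = expectation (\<lambda>\<omega>. F (Z (Suc 0) (p - q) \<omega>, Z (Suc 0) 0 \<omega>))"
    if l: "l > 0" and [measurable]: "F \<in> borel_measurable (borel \<Otimes>\<^sub>M borel)" for F :: "real \<times> real \<Rightarrow> real" and l p q
  proof -
    define G where "G = (\<lambda>z :: real \<times> real. F (\<bar>fst z\<bar> powr \<gamma>, \<bar>snd z\<bar> powr \<gamma>))"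
    have [measurable]: "G \<in> borel_measurable (borel \<Otimes>\<^sub>M borel)" unfolding G_def by measurable
    let ?u = "\<lambda>\<omega>. (real l powr H * incr K a X p l \<omega>, real l powr H * incr K a X q l \<omega>)"
    let ?v = "\<lambda>\<omega>. (incr K a X (p - q) 1 \<omega>, incr K a X 0 1 \<omega>)"
    have eq: "distr M (borel \<Otimes>\<^sub>M borel) ?u = distr M (borel \<Otimes>\<^sub>M borel) ?v"
      by (rule distr_incr_pair[OF X a l])
    have u: "?u \<in> measurable M (borel \<Otimes>\<^sub>M borel)" and v: "?v \<in> measurable M (borel \<Otimes>\<^sub>M borel)"
      by measurable
    have Gu: "(\<lambda>\<omega>. F (Z l p \<omega>, Z l q \<omega>)) = (\<lambda>\<omega>. G (?u \<omega>))"
      and Gv: "(\<lambda>\<omega>. F (Z (Suc 0) (p - q) \<omega>, Z (Suc 0) 0 \<omega>)) = (\<lambda>\<omega>. G (?v \<omega>))"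
      by (simp_all add: Z_def G_def)
    show "integrable M (\<lambda>\<omega>. F (Z l p \<omega>, Z l q \<omega>)) \<longleftrightarrow> integrable M (\<lambda>\<omega>. F (Z (Suc 0) (p - q) \<omega>, Z (Suc 0) 0 \<omega>))"
      unfolding Gu Gv
      using integrable_distr_eq[OF u, of G] integrable_distr_eq[OF v, of G] eq by simp
    show "expectation (\<lambda>\<omega>. F (Z l p \<omega>, Z l q \<omega>)) = expectation (\<lambda>\<omega>. F (Z (Suc 0) (p - q) \<omega>, Z (Suc 0) 0 \<omega>))"
      unfolding Gu Gv
      using integral_distr[OF u, of G] integral_distr[OF v, of G] eq by simp
  qed
  have "- 1 < \<gamma>" using \<gamma> by simp
  have int0: "integrable M (Z (Suc 0) 0)"
    unfolding Z1 by (rule integrable_SaS_neg_powr[OF prob_space_axioms Y \<open>- 1 < \<gamma>\<close> \<gamma>(2)])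
  have exp0: "expectation (Z (Suc 0) 0) = m"
    unfolding Z1 m_def by (rule expectation_SaS_neg_powr[OF prob_space_axioms Y \<open>- 1 < \<gamma>\<close> \<gamma>(2)])
  have sq0: "integrable M (\<lambda>\<omega>. (Z (Suc 0) 0 \<omega>)\<^sup>2)"
  proof -
    have "(Z (Suc 0) 0 \<omega>)\<^sup>2 = \<bar>incr K a X 0 1 \<omega>\<bar> powr (2 * \<gamma>)" for \<omega>
      unfolding Z1 power2_eq_square powr_add[symmetric] by simp
    moreover have "- 1 < 2 * \<gamma>" "2 * \<gamma> < 0" using \<gamma> by simp_all
    ultimately show ?thesis
      by (simp only: integrable_SaS_neg_powr[OF prob_space_axioms Y])
  qed
  have intZ: "integrable M (Z l p)" and expZ: "expectation (Z l p) = m"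
    and sqZ: "integrable M (\<lambda>\<omega>. (Z l p \<omega>)\<^sup>2)" if "l > 0" for l p
    using transfer[OF that, of snd p p] transfer[OF that, of "\<lambda>z. (snd z)\<^sup>2" p p] int0 exp0 sq0 by simp_all
  have sqZm: "integrable M (\<lambda>\<omega>. (Z l p \<omega> - m)\<^sup>2)" if "l > 0" for l p
    unfolding power2_diff using intZ[OF that] sqZ[OF that] by simp
  have npos: "n > 0" using n by simp
  have W: "W K a X H \<gamma> n \<omega> = 1 / real (n - K + 1) * (\<Sum>p<n - K + 1. Z n (int p) \<omega>)" for \<omega>
    unfolding Z_def by (rule W_eq_average[OF n(2) npos])
  define cov where "cov = (\<lambda>k. covariance M (Z (Suc 0) k) (Z (Suc 0) 0))"
  have int: "integrable M (\<lambda>\<omega>. (Z n p \<omega> - m) * (Z n q \<omega> - m))" for p q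
    using sqZm[OF npos] by (intro integrable_mult_of_squares) auto
  have cov: "expectation (\<lambda>\<omega>. (Z n p \<omega> - m) * (Z n q \<omega> - m)) = cov (p - q)" for p q
    unfolding cov_def covariance_def
    using transfer(2)[OF npos, of "\<lambda>z. (fst z - m) * (snd z - m)" p q] by (simp add: expZ)
  have N: "0 < n - K + 1" "n - K + 1 \<le> n + 1" by auto
  show "integrable M (\<lambda>\<omega>. (W K a X H \<gamma> n \<omega> - neg_moment \<alpha> \<sigma> (- \<gamma>))\<^sup>2)"
    unfolding m_def[symmetric] W
    by (rule integrable_average_square[OF N, where c = cov]) (auto simp: int cov)
  have "expectation (\<lambda>\<omega>. (W K a X H \<gamma> n \<omega> - m)\<^sup>2) \<le> 1 / real (n - K + 1) * (\<Sum>k=-int n..int n. \<bar>cov k\<bar>)"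
    unfolding W by (rule average_second_moment_le[OF N]) (auto simp: int cov)
  then show "expectation (\<lambda>\<omega>. (W K a X H \<gamma> n \<omega> - neg_moment \<alpha> \<sigma> (- \<gamma>))\<^sup>2)
      \<le> 1 / real (n - K + 1) * (\<Sum>k = - int n..int n.
          \<bar>covariance M (\<lambda>\<omega>. \<bar>incr K a X k 1 \<omega>\<bar> powr \<gamma>) (\<lambda>\<omega>. \<bar>incr K a X 0 1 \<omega>\<bar> powr \<gamma>)\<bar>)"
    unfolding m_def[symmetric] cov_def Z1 by simp
qed

text \<open>The bound on the second moment carries the factor \<open>1 / (n - K + 1)\<close> in place of the \<open>1 / n\<close> of the
covariance hypothesis; for \<open>n \<ge> K\<close> the two differ at most by the factor \<open>K\<close>.\<close>

lemma (in prob_space) bigo_in_prob_W: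
  fixes b :: "nat \<Rightarrow> real"
  assumes X: "real_process M X" "self_similar M H X" "stationary_increments M X"
    and a: "(\<Sum>k\<le>K. a k) = 0" and K: "K \<ge> 1"
    and Y: "SaS_scale M \<alpha> \<sigma> (incr K a X 0 1)" "\<alpha> > 0" "\<sigma> > 0"
    and \<gamma>: "- 1/2 < \<gamma>" "\<gamma> < 0" and b: "\<And>n. b n > 0"
    and limsup: "limsup (\<lambda>n. ereal (1 / (real n * (b n)\<^sup>2) * (\<Sum>k = - int n..int n.
        \<bar>covariance M (\<lambda>\<omega>. \<bar>incr K a X k 1 \<omega>\<bar> powr \<gamma>) (\<lambda>\<omega>. \<bar>incr K a X 0 1 \<omega>\<bar> powr \<gamma>)\<bar>))) \<le> ereal D"
  shows "bigo_in_prob M {n. n \<ge> K} (\<lambda>n \<omega>. W K a X H \<gamma> n \<omega> - neg_moment \<alpha> \<sigma> (- \<gamma>)) b"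
proof (rule bigo_in_prob_second_moment)
  show "{n. n \<ge> K} \<noteq> {}" by auto
  show "(\<lambda>\<omega>. W K a X H \<gamma> n \<omega> - neg_moment \<alpha> \<sigma> (- \<gamma>)) \<in> borel_measurable M" for n
    using measurable_W[OF X(1)] by simp
  show "integrable M (\<lambda>\<omega>. (W K a X H \<gamma> n \<omega> - neg_moment \<alpha> \<sigma> (- \<gamma>))\<^sup>2)" if "n \<in> {n. n \<ge> K}" for n
    using that by (intro integrable_W_square[OF X a K _ Y \<gamma>]) simp
  define S where "S = (\<lambda>n. \<Sum>k = - int n..int n.
        \<bar>covariance M (\<lambda>\<omega>. \<bar>incr K a X k 1 \<omega>\<bar> powr \<gamma>) (\<lambda>\<omega>. \<bar>incr K a X 0 1 \<omega>\<bar> powr \<gamma>)\<bar>)"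
  have "limsup (\<lambda>n. ereal (1 / (real n * (b n)\<^sup>2) * S n)) < ereal (D + 1)"
    using limsup unfolding S_def by (rule le_less_trans) simp
  then have "\<forall>\<^sub>F n in sequentially. ereal (1 / (real n * (b n)\<^sup>2) * S n) < ereal (D + 1)"
    by (rule Limsup_lessD)
  then show "\<forall>\<^sub>F n in sequentially. n \<in> {n. n \<ge> K} \<longrightarrow>
      expectation (\<lambda>\<omega>. (W K a X H \<gamma> n \<omega> - neg_moment \<alpha> \<sigma> (- \<gamma>))\<^sup>2) \<le> (real K * (D + 1)) * (b n)\<^sup>2"
  proof eventually_elim
    case (elim n)
    show ?case
    proof
      assume "n \<in> {n. n \<ge> K}"
      then have n: "n \<ge> K" and npos: "n > 0" using K by auto
      have S0: "S n \<ge> 0" unfolding S_def by (rule sum_nonneg) simp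
      have bn: "(b n)\<^sup>2 > 0" using b[of n] by simp
      have "1 / (real n * (b n)\<^sup>2) * S n < D + 1" using elim by simp
      then have Sn: "S n \<le> (D + 1) * (real n * (b n)\<^sup>2)"
        using npos bn by (simp add: pos_divide_less_eq)
      have "n \<le> K * (n - K + 1)"
      proof -
        obtain j where j: "n = K + j" using n le_Suc_ex by blast
        have "j \<le> K * j" using K by simp
        then show ?thesis by (simp add: j)
      qed
      then have "real n \<le> real K * real (n - K + 1)" by (metis of_nat_le_iff of_nat_mult)
      then have "1 / real (n - K + 1) \<le> real K / real n"
        using npos by (simp add: field_simps)
      have "expectation (\<lambda>\<omega>. (W K a X H \<gamma> n \<omega> - neg_moment \<alpha> \<sigma> (- \<gamma>))\<^sup>2) \<le> 1 / real (n - K + 1) * S n"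
        unfolding S_def by (rule W_second_moment_le[OF X a K n Y \<gamma>])
      also have "\<dots> \<le> real K / real n * S n"
        using \<open>1 / real (n - K + 1) \<le> real K / real n\<close> S0 by (rule mult_right_mono)
      also have "\<dots> \<le> real K / real n * ((D + 1) * (real n * (b n)\<^sup>2))"
        using Sn by (intro mult_left_mono) auto
      also have "\<dots> = (real K * (D + 1)) * (b n)\<^sup>2" using npos by simp
      finally show "expectation (\<lambda>\<omega>. (W K a X H \<gamma> n \<omega> - neg_moment \<alpha> \<sigma> (- \<gamma>))\<^sup>2) \<le> (real K * (D + 1)) * (b n)\<^sup>2" .
    qed
  qed
qed (rule b)

section \<open>The functions relating moments and stability index\<close>

lemma ln_neg_moment:
  assumes "\<alpha> > 0" "\<sigma> > 0" "0 < p" "p < 1"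
  shows "ln (neg_moment \<alpha> \<sigma> p) = - p * ln \<sigma> - p * ln 2 + ln (Gamma ((1 - p) / 2)) + ln (Gamma (1 + p / \<alpha>))
      - ln pi / 2 - ln (Gamma (1 + p / 2))"
proof -
  have g: "Gamma ((1 - p) / 2) > 0" "Gamma (1 + p / \<alpha>) > 0" "Gamma (1 + p / 2) > 0"
    using assms by (auto intro!: Gamma_real_pos add_pos_pos)
  have "ln (neg_moment \<alpha> \<sigma> p) = ln (\<sigma> powr (- p)) + ln (2 powr (- p)) + ln (Gamma ((1 - p) / 2))
      + ln (Gamma (1 + p / \<alpha>)) - (ln (sqrt pi) + ln (Gamma (1 + p / 2)))"
    unfolding neg_moment_def using g assms by (simp add: ln_mult_pos ln_divide_pos)
  then show ?thesis using assms by (simp add: ln_powr ln_sqrt)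
qed

text \<open>The weights \<open>- v\<close> and \<open>u\<close> cancel the unknown scale \<open>\<sigma>\<close> from the logarithms of the two moments, and
\<open>C_const\<close> removes all terms that do not depend on \<open>\<alpha>\<close>. What remains is a function of \<open>\<alpha>\<close>, the
quantity to be estimated.\<close>

lemma psi_neg_moment:
  assumes "\<alpha> > 0" "\<sigma> > 0" "0 < v" "v < 1" "0 < u" "u < 1"
  shows "psi u v (neg_moment \<alpha> \<sigma> u) (neg_moment \<alpha> \<sigma> v) = h_fun u v \<alpha>"
  unfolding psi_def C_const_def h_fun_def
  using assms by (simp add: ln_neg_moment algebra_simps) (simp add: field_simps)

context
  fixes u v :: real
  assumes uv: "0 < v" "v < u"
begin

lemma DERIV_h_fun:
  assumes x: "x > 0"
  shows "DERIV (h_fun u v) x :> u * v / x\<^sup>2 * (Digamma (1 + u / x) - Digamma (1 + v / x))"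
proof -
  have D: "DERIV (\<lambda>x. ln (Gamma (1 + c / x))) x :> Digamma (1 + c / x) * (- c / x\<^sup>2)" if c: "c > 0" for c
  proof -
    have pos: "1 + c / x > 0" using c x by (simp add: add_pos_pos)
    then have "1 + c / x \<notin> \<int>\<^sub>\<le>\<^sub>0" using nonpos_Ints_nonpos[of "1 + c / x"] by auto
    then have "DERIV Gamma (1 + c / x) :> Gamma (1 + c / x) * Digamma (1 + c / x)"
      by (rule has_field_derivative_Gamma)
    moreover have "DERIV (\<lambda>x. 1 + c / x) x :> - c / x\<^sup>2"
      using x by (auto intro!: derivative_eq_intros simp: power2_eq_square)
    ultimately have "DERIV (\<lambda>x. Gamma (1 + c / x)) x :> Gamma (1 + c / x) * Digamma (1 + c / x) * (- c / x\<^sup>2)"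
      by (rule DERIV_chain2)
    moreover have "DERIV ln (Gamma (1 + c / x)) :> 1 / Gamma (1 + c / x)"
      using pos by (intro DERIV_ln_divide Gamma_real_pos)
    ultimately have "DERIV (\<lambda>x. ln (Gamma (1 + c / x))) x :>
        1 / Gamma (1 + c / x) * (Gamma (1 + c / x) * Digamma (1 + c / x) * (- c / x\<^sup>2))"
      by (intro DERIV_chain2[where f = ln])
    then show ?thesis using Gamma_real_pos[OF pos] by simp
  qed
  have "DERIV (\<lambda>x. u * ln (Gamma (1 + v / x)) - v * ln (Gamma (1 + u / x))) x :>
      u * (Digamma (1 + v / x) * (- v / x\<^sup>2)) - v * (Digamma (1 + u / x) * (- u / x\<^sup>2))"
    using uv by (intro DERIV_diff DERIV_cmult D) auto
  moreover have "h_fun u v = (\<lambda>x. u * ln (Gamma (1 + v / x)) - v * ln (Gamma (1 + u / x)))"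
    by (simp add: h_fun_def fun_eq_iff)
  moreover have "u * (Digamma (1 + v / x) * (- v / x\<^sup>2)) - v * (Digamma (1 + u / x) * (- u / x\<^sup>2))
      = u * v / x\<^sup>2 * (Digamma (1 + u / x) - Digamma (1 + v / x))"
    by (simp add: algebra_simps)
  ultimately show ?thesis by simp
qed

text \<open>The Digamma function is strictly increasing, that is, \<open>ln Gamma\<close> is strictly convex. Both the
injectivity of \<open>h_fun\<close> and the differentiability of its inverse come from this.\<close>

lemma h_fun_deriv_pos:
  assumes "x > 0"
  shows "u * v / x\<^sup>2 * (Digamma (1 + u / x) - Digamma (1 + v / x)) > 0"
proof -
  have "Digamma (1 + v / x) < Digamma (1 + u / x)"
    using uv assms by (intro Digamma_real_strict_mono) (auto intro: add_pos_pos divide_strict_right_mono)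
  then show ?thesis using uv assms by simp
qed

lemma h_fun_strict_mono: "0 < x \<Longrightarrow> x < y \<Longrightarrow> h_fun u v x < h_fun u v y"
  by (rule DERIV_pos_imp_increasing[where f = "h_fun u v"], assumption)
    (meson DERIV_h_fun h_fun_deriv_pos less_le_trans)

lemma continuous_on_h_fun: "continuous_on {0<..} (h_fun u v)"
  by (rule continuous_at_imp_continuous_on) (use DERIV_h_fun DERIV_isCont in force)

lemma h_fun_tendsto_0: "(h_fun u v \<longlongrightarrow> 0) at_top"
proof -
  have "((\<lambda>x. ln (Gamma (1 + c / x))) \<longlongrightarrow> ln (Gamma (1 + 0))) at_top" for c :: real
  proof (intro tendsto_ln tendsto_Gamma tendsto_add tendsto_const)
    show "((\<lambda>x. c / x) \<longlongrightarrow> 0) at_top"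
      by (intro tendsto_divide_0[OF tendsto_const] filterlim_at_top_imp_at_infinity filterlim_ident)
  qed auto
  then have "((\<lambda>x. ln (Gamma (1 + c / x))) \<longlongrightarrow> 0) at_top" for c :: real
    by simp
  then have "((\<lambda>x. u * ln (Gamma (1 + v / x)) - v * ln (Gamma (1 + u / x))) \<longlongrightarrow> u * 0 - v * 0) at_top"
    by (intro tendsto_intros)
  then show ?thesis by (simp add: h_fun_def[abs_def])
qed

lemma h_fun_neg:
  assumes x: "x > 0"
  shows "h_fun u v x < 0"
proof -
  have "h_fun u v (x + 1) \<le> 0"
  proof (rule tendsto_lowerbound[OF h_fun_tendsto_0])
    show "\<forall>\<^sub>F y in at_top. h_fun u v (x + 1) \<le> h_fun u v y"
      using eventually_gt_at_top[of "x + 1"]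
      by eventually_elim (use x in \<open>auto intro!: less_imp_le h_fun_strict_mono\<close>)
  qed simp
  moreover have "h_fun u v x < h_fun u v (x + 1)" using x by (intro h_fun_strict_mono) auto
  ultimately show ?thesis by simp
qed

lemma inj_on_h_fun: "inj_on (h_fun u v) {0<..}"
  by (rule linorder_inj_onI) (use h_fun_strict_mono in \<open>force\<close>)+

lemma phi_h_fun: "x > 0 \<Longrightarrow> phi u v (h_fun u v x) = x"
  using h_fun_neg[of x] inj_on_h_fun by (simp add: phi_def inv_into_f_f)

lemma DERIV_phi:
  assumes x: "x > 0"
  shows "DERIV (phi u v) (h_fun u v x) :> inverse (u * v / x\<^sup>2 * (Digamma (1 + u / x) - Digamma (1 + v / x)))"
proof -
  let ?D = "u * v / x\<^sup>2 * (Digamma (1 + u / x) - Digamma (1 + v / x))"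
  have "(phi u v has_derivative (*) (inverse ?D)) (at (h_fun u v x))"
  proof (rule has_derivative_inverse_strong[where S = "{0<..}" and f = "h_fun u v" and x = x and f' = "(*) ?D"])
    show "(h_fun u v has_derivative (*) ?D) (at x)"
      using DERIV_h_fun[OF x] by (rule has_field_derivative_imp_has_derivative)
    show "(*) ?D \<circ> (*) (inverse ?D) = id"
      using h_fun_deriv_pos[OF x] by (auto simp: fun_eq_iff)
  qed (use x continuous_on_h_fun phi_h_fun in auto)
  then show ?thesis by (simp add: has_field_derivative_def)
qed

text \<open>On the range of \<open>h_fun\<close>, which is an interval, \<open>phi\<close> is increasing as the inverse of an increasing
function; elsewhere it is piecewise constant.\<close>

lemma measurable_phi: "phi u v \<in> borel_measurable borel"
proof -
  let ?R = "h_fun u v ` {0<..}"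
  have "is_interval ?R"
    unfolding is_interval_connected_1
    by (intro connected_continuous_image continuous_on_h_fun) (simp flip: is_interval_connected_1)
  then have "?R \<in> sets borel" by (rule real_interval_borel_measurable)
  show ?thesis
  proof (rule borel_measurable_piecewise_mono[of "{?R, {..<0} - ?R, {0..}}"])
    fix c assume "c \<in> {?R, {..<0} - ?R, {0..}}"
    then show "c \<in> sets borel" using \<open>?R \<in> sets borel\<close> by auto
  next
    fix c assume "c \<in> {?R, {..<0} - ?R, {0..}}"
    then consider "c = ?R" | "c = {..<0} - ?R" | "c = {0..}" by blast
    then show "mono_on c (phi u v)"
    proof cases
      case 1
      show ?thesis
        unfolding 1
      proof (rule mono_onI)
        fix y z assume "y \<in> ?R" "z \<in> ?R" "y \<le> z"
        then obtain s t where st: "s > 0" "t > 0" "y = h_fun u v s" "z = h_fun u v t" by auto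
        then have "s \<le> t" using \<open>y \<le> z\<close> h_fun_strict_mono[of t s] by force
        then show "phi u v y \<le> phi u v z" using st by (simp add: phi_h_fun)
      qed
    next
      case 2
      \<comment> \<open>Off the range of \<open>h_fun\<close> the Hilbert choice in \<open>inv_into\<close> does not depend on the argument.\<close>
      have "phi u v y = (SOME x. False)" if "y \<in> {..<0} - ?R" for y
      proof -
        have "(\<lambda>x. x \<in> {0<..} \<and> h_fun u v x = y) = (\<lambda>x. False)" using that by (auto simp: fun_eq_iff)
        then show ?thesis using that by (simp add: phi_def inv_into_def)
      qed
      then show ?thesis unfolding 2 by (intro mono_onI) simp
    next
      case 3
      then show ?thesis by (auto intro!: mono_onI simp: phi_def)
    qed
  qed auto
qed

lemma differentiable_phi_psi:
  assumes "x > 0" "y > 0" "psi u v x y = h_fun u v z" "z > 0"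
  shows "(\<lambda>w. phi u v (psi u v (fst w) (snd w))) differentiable (at (x, y))"
proof -
  have ln1: "((\<lambda>w. ln (fst w)) has_derivative (\<lambda>w. fst w * inverse x)) (at (x, y))"
    using assms by (auto intro!: derivative_eq_intros simp: fun_eq_iff divide_inverse)
  have ln2: "((\<lambda>w. ln (snd w)) has_derivative (\<lambda>w. snd w * inverse y)) (at (x, y))"
    using assms by (auto intro!: derivative_eq_intros simp: fun_eq_iff divide_inverse)
  have "(\<lambda>w. - v * ln (fst w) + u * ln (snd w) + C_const u v) differentiable (at (x, y))"
    using ln1 ln2 by (intro differentiable_add differentiable_mult differentiable_const)
      (auto simp: differentiable_def)
  then have "(\<lambda>w. psi u v (fst w) (snd w)) differentiable (at (x, y))"
    by (simp add: psi_def)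
  moreover have "phi u v differentiable (at (psi u v (fst (x, y)) (snd (x, y))))"
    using DERIV_phi[OF assms(4)] assms(3)
    by (auto simp: differentiable_def has_field_derivative_def)
  ultimately show ?thesis
    using differentiable_chain_at[of "\<lambda>w. psi u v (fst w) (snd w)" "(x, y)" "phi u v"]
    by (simp add: comp_def)
qed

end

section \<open>The estimators\<close>

lemma differentiable_log_ratio:
  assumes "m > 0" "c > 0"
  shows "(\<lambda>w. k * log 2 (c * (fst w / snd w))) differentiable (at (m, m :: real))"
proof -
  have "(\<lambda>w :: real \<times> real. c * (fst w / snd w)) differentiable (at (m, m))"
    using assms by (intro differentiable_mult differentiable_divide differentiable_const bounded_linear_imp_differentiable bounded_linear_fst bounded_linear_snd) auto
  moreover have "(\<lambda>t. k * log 2 t) differentiable (at (c * (fst (m, m) / snd (m, m))))"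
  proof -
    have "DERIV (\<lambda>t. k * log 2 t) c :> k * (1 / (ln 2 * c))"
      using assms by (intro DERIV_cmult DERIV_log) auto
    then show ?thesis using assms by (auto simp: differentiable_def has_field_derivative_def)
  qed
  ultimately show ?thesis
    using differentiable_chain_at[of "\<lambda>w. c * (fst w / snd w)" "(m, m)" "\<lambda>t. k * log 2 t"]
    by (simp add: comp_def)
qed

text \<open>Replacing \<open>V\<close> by \<open>W\<close> exposes the parameter: the two normalisations differ by \<open>2 powr (\<beta> * H)\<close>, and the
two statistics in the remaining ratio have the same limit.\<close>

lemma H_hat_eq_W:
  assumes "even n" "n > 0"
  shows "H_hat K a X \<beta> n \<omega> = 1 / \<beta> * log 2 (2 powr (\<beta> * H) * (W K a X H \<beta> (n div 2) \<omega> / W K a X H \<beta> n \<omega>))"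
proof -
  define r where "r = real n powr (\<beta> * H)"
  have r: "r > 0" using assms by (simp add: r_def)
  have half: "real (n div 2) = real n / 2" using assms by (simp add: real_of_nat_div)
  have "real (n div 2) powr (\<beta> * H) = r / 2 powr (\<beta> * H)"
    unfolding half r_def by (simp add: powr_divide)
  then have "2 powr (\<beta> * H) * (W K a X H \<beta> (n div 2) \<omega> / W K a X H \<beta> n \<omega>) = V K a X \<beta> (n div 2) \<omega> / V K a X \<beta> n \<omega>"
    using r unfolding W_def r_def[symmetric] by simp
  then show ?thesis by (simp add: H_hat_def)
qed

theorem theorem2p1:
  fixes M :: "'a measure" and X :: "real \<Rightarrow> 'a \<Rightarrow> real"
    and \<alpha> H \<beta> \<beta>1 \<beta>2 :: real and L K :: nat and a :: "nat \<Rightarrow> real" and b :: "nat \<Rightarrow> real"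
  assumes "prob_space M"
    and "real_process M X"
    and "0 < \<alpha>" and "\<alpha> \<le> 2"
    and "self_similar M H X"
    and "stationary_increments M X"
    and "SaS_process M \<alpha> X"
    and "L \<ge> 1" and "K \<ge> 1"
    and "increment_coeffs L K a"
    and "SaS_variable M \<alpha> (incr K a X 0 1)"
    and "- 1/2 < \<beta>" and "\<beta> < 0"
    and "- 1/2 < \<beta>1" and "\<beta>1 < \<beta>2" and "\<beta>2 < 0"
    and "\<And>n. b n > 0"
    and "b \<longlonglongrightarrow> 0"
    and "(\<lambda>n. b (n div 2)) \<in> O[inf sequentially (principal {n. even n})](b)"
    and "\<And>\<gamma>. \<gamma> \<in> {\<beta>, \<beta>1, \<beta>2} \<Longrightarrow>
           \<exists>C::real. limsup (\<lambda>n. ereal (1 / (real n * (b n)\<^sup>2) *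
             (\<Sum>k = - int n..int n.
                \<bar>covariance M (\<lambda>\<omega>. \<bar>incr K a X k 1 \<omega>\<bar> powr \<gamma>) (\<lambda>\<omega>. \<bar>incr K a X 0 1 \<omega>\<bar> powr \<gamma>)\<bar>)))
             \<le> ereal (C\<^sup>2)"
  shows "converges_in_prob M {n. even n \<and> n \<ge> 2 * K} (H_hat K a X \<beta>) H
       \<and> converges_in_prob M {n. n \<ge> K} (alpha_hat K a X H \<beta>1 \<beta>2) \<alpha>
       \<and> bigo_in_prob M {n. even n \<and> n \<ge> 2 * K} (\<lambda>n \<omega>. H_hat K a X \<beta> n \<omega> - H) b
       \<and> bigo_in_prob M {n. n \<ge> K} (\<lambda>n \<omega>. alpha_hat K a X H \<beta>1 \<beta>2 n \<omega> - \<alpha>) b"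
proof -
  interpret prob_space M by fact
  note X = assms(2,5,6) and b = assms(17,18)
  let ?I = "{n. even n \<and> n \<ge> 2 * K}" and ?J = "{n. n \<ge> K}"
  have "2 * K \<in> ?I" by simp
  then have I: "?I \<noteq> {}" by blast
  have J: "?J \<noteq> {}" by auto
  have a: "(\<Sum>k\<le>K. a k) = 0"
    using assms(10) unfolding increment_coeffs_def by (auto dest: spec[of _ 0])
  obtain \<sigma> where \<sigma>: "\<sigma> > 0" "SaS_scale M \<alpha> \<sigma> (incr K a X 0 1)"
    using assms(11) unfolding SaS_variable_def by blast
  have W: "bigo_in_prob M ?J (\<lambda>n \<omega>. W K a X H \<gamma> n \<omega> - neg_moment \<alpha> \<sigma> (- \<gamma>)) b"
    if \<gamma>: "\<gamma> \<in> {\<beta>, \<beta>1, \<beta>2}" for \<gamma>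
  proof -
    obtain C :: real where "limsup (\<lambda>n. ereal (1 / (real n * (b n)\<^sup>2) * (\<Sum>k = - int n..int n.
        \<bar>covariance M (\<lambda>\<omega>. \<bar>incr K a X k 1 \<omega>\<bar> powr \<gamma>) (\<lambda>\<omega>. \<bar>incr K a X 0 1 \<omega>\<bar> powr \<gamma>)\<bar>))) \<le> ereal (C\<^sup>2)"
      using assms(20)[OF \<gamma>] by blast
    moreover have "- 1/2 < \<gamma>" "\<gamma> < 0" using \<gamma> assms(12-16) by auto
    ultimately show ?thesis
      using \<sigma> assms(3,9) b(1) X a by (intro bigo_in_prob_W) auto
  qed
  note mW = measurable_W[OF X(1)]

  \<comment> \<open>The Hurst index: the delta method for a logarithmic ratio at a point with equal coordinates.\<close>
  define m where "m = neg_moment \<alpha> \<sigma> (- \<beta>)"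
  have m: "m > 0" unfolding m_def using assms(3,12,13) \<sigma>(1) by (intro neg_moment_pos) auto
  define g where "g = (\<lambda>w :: real \<times> real. 1 / \<beta> * log 2 (2 powr (\<beta> * H) * (fst w / snd w)))"
  have gm: "g (m, m) = H" using m assms(13) by (simp add: g_def)
  have "inf sequentially (principal ?I) \<le> inf sequentially (principal {n. even n})"
    by (intro inf_mono) auto
  then have O: "(\<lambda>n. b (n div 2)) \<in> O[inf sequentially (principal ?I)](b)"
    using assms(19) by (rule landau_o.big.filter_mono)
  have W\<beta>: "bigo_in_prob M ?J (\<lambda>n \<omega>. W K a X H \<beta> n \<omega> - m) b"
    using W[of \<beta>] by (simp add: m_def)
  have "bigo_in_prob M ?I (\<lambda>n \<omega>. W K a X H \<beta> n \<omega> - m) b"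
    by (rule bigo_in_prob_subset[OF I _ b(1) W\<beta>]) auto
  moreover have "bigo_in_prob M ?I (\<lambda>n \<omega>. W K a X H \<beta> (n div 2) \<omega> - m) b"
    by (rule bigo_in_prob_half[OF I _ b(1) O W\<beta>]) auto
  ultimately have "bigo_in_prob M ?I (\<lambda>n \<omega>. g (W K a X H \<beta> (n div 2) \<omega>, W K a X H \<beta> n \<omega>) - g (m, m)) b"
  proof (intro bigo_in_prob_delta_method[OF I b])
    show "g differentiable (at (m, m))"
      unfolding g_def using m by (intro differentiable_log_ratio) auto
    show "(\<lambda>\<omega>. g (W K a X H \<beta> (n div 2) \<omega>, W K a X H \<beta> n \<omega>)) \<in> borel_measurable M" for n
      using mW unfolding g_def by simp
  qed
  moreover have "g (W K a X H \<beta> (n div 2) \<omega>, W K a X H \<beta> n \<omega>) = H_hat K a X \<beta> n \<omega>" if "n \<in> ?I" for n \<omega>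
    using that assms(9) H_hat_eq_W[of n K a X \<beta> \<omega> H] by (simp add: g_def)
  ultimately have bigoH: "bigo_in_prob M ?I (\<lambda>n \<omega>. H_hat K a X \<beta> n \<omega> - H) b"
    unfolding gm bigo_in_prob_def by simp

  \<comment> \<open>The stability index: the delta method for \<open>phi\<close> after \<open>psi\<close> at the pair of true moments.\<close>
  define u v where "u = - \<beta>1" and "v = - \<beta>2"
  have uv: "0 < v" "v < u" "u < 1" using assms(14-16) by (auto simp: u_def v_def)
  define m1 m2 where "m1 = neg_moment \<alpha> \<sigma> u" and "m2 = neg_moment \<alpha> \<sigma> v"
  have m12: "m1 > 0" "m2 > 0" unfolding m1_def m2_def using assms(3) \<sigma>(1) uv by (auto intro!: neg_moment_pos)
  have psi: "psi u v m1 m2 = h_fun u v \<alpha>"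
    unfolding m1_def m2_def using assms(3) \<sigma>(1) uv by (intro psi_neg_moment) auto
  define f where "f = (\<lambda>w. phi u v (psi u v (fst w) (snd w)))"
  have fm: "f (m1, m2) = \<alpha>" using phi_h_fun[OF uv(1,2) assms(3)] by (simp add: f_def psi)
  have "bigo_in_prob M ?J (\<lambda>n \<omega>. f (W K a X H \<beta>1 n \<omega>, W K a X H \<beta>2 n \<omega>) - f (m1, m2)) b"
  proof (rule bigo_in_prob_delta_method[OF J b])
    show "bigo_in_prob M ?J (\<lambda>n \<omega>. W K a X H \<beta>1 n \<omega> - m1) b"
      "bigo_in_prob M ?J (\<lambda>n \<omega>. W K a X H \<beta>2 n \<omega> - m2) b"
      using W[of \<beta>1] W[of \<beta>2] by (simp_all add: m1_def m2_def u_def v_def)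
    show "f differentiable (at (m1, m2))"
      unfolding f_def by (rule differentiable_phi_psi[OF uv(1,2) m12 psi assms(3)])
    show "(\<lambda>\<omega>. f (W K a X H \<beta>1 n \<omega>, W K a X H \<beta>2 n \<omega>)) \<in> borel_measurable M" for n
    proof -
      have "(\<lambda>\<omega>. psi u v (W K a X H \<beta>1 n \<omega>) (W K a X H \<beta>2 n \<omega>)) \<in> borel_measurable M"
        using mW unfolding psi_def by simp
      from measurable_compose[OF this measurable_phi[OF uv(1,2)]] show ?thesis
        by (simp add: f_def)
    qed
  qed
  then have bigoA: "bigo_in_prob M ?J (\<lambda>n \<omega>. alpha_hat K a X H \<beta>1 \<beta>2 n \<omega> - \<alpha>) b"
    unfolding fm by (simp add: f_def alpha_hat_def u_def v_def)

  show ?thesis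
    using bigoH bigoA bigo_in_prob_imp_converges[OF I b bigoH] bigo_in_prob_imp_converges[OF J b bigoA] by blast
qed

end
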